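(* Let $d\ge1$ be a fixed integer and let $q=(q_1,\dots,q_d)$ with $q_l\in\{1,2\}$ for every $1\le l\le d$. Let $V:\mathbb{Z}^d\to\mathbb{R}$ be periodic with respect to $\mathbb{L}=\{n_1q_1e_1+\cdots+n_dq_de_d:\ n_1,\dots,n_d\in\mathbb{Z}\}$, i.e. $V(x+y)=V(x)$ for all $x\in\mathbb{Z}^d$, $y\in\mathbb{L}$. For each $N\in\mathbb{N}$ let $\Lambda_N=\prod_{l=1}^d\{1,\dots,q_lN\}$, let $\mathcal{H}_{\Lambda_N}$ be the Dirichlet-truncated periodic Schrödinger operator on $\ell^2(\Lambda_N)$ with potential $V$, and let $\{\psi_N^{(j)}\}_{j=1}^{\#\Lambda_N}$ be an orthonormal basis of $\ell^2(\Lambda_N)$ consisting of eigenfunctions of $\mathcal{H}_{\Lambda_N}$. Let $a_N:\Lambda_N\times\Lambda_N\to\mathbb{C}$ be a sequence of diagonal observables such that (i) $\|a_N\|_\infty:=\sup_{x\in\Lambda_N}|a_N(x,x)|\le1$ for all $N\in\mathbb{N}$; (ii) for all $N\in\mathbb{N}$ and all $x,y\in\Lambda_1$, $$\sum_{k\in\mathbb{L}_N}a_N(x+k,x+k)=\sum_{k\in\mathbb{L}_N}a_N(y+k,y+k),$$ where $\mathbb{L}_N=\{n_1q_1e_1+\cdots+n_dq_de_d:\ n_1,\dots,n_d\in\{0,\dots,N-1\}\}$. (In particular, (ii) holds if $a_N(x+k,x+k)=a_N(y+k,y+k)$ for all $x,y\in\Lambda_1$, $k\in\mathbb{L}_N$.)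 Then $$\lim_{N\to\infty}\frac{1}{\#\Lambda_N}\sum_{j=1}^{\#\Lambda_N}\left|\langle\psi_N^{(j)},a_N\psi_N^{(j)}\rangle-\langle a_N\rangle\right|^2=0,$$ where $\langle a_N\rangle=\frac{1}{\#\Lambda_N}\sum_{x\in\Lambda_N}a_N(x,x)$.
   Context: $\mathbb{N}$ denotes the positive integers and $e_1,\dots,e_d$ the standard basis of $\mathbb{Z}^d$. $\ell^2(\Lambda_N)$ is the space of functions $\Lambda_N\to\mathbb{C}$ with inner product $\langle\varphi,\psi\rangle=\sum_{x\in\Lambda_N}\overline{\varphi(x)}\psi(x)$. The Dirichlet truncation is $$(\mathcal{H}_{\Lambda_N}\psi)(x)=\sum_{y\in\Lambda_N,\ \|y-x\|_1=1}\psi(y)+V(x)\psi(x),\qquad \psi\in\ell^2(\Lambda_N),\ x\in\Lambda_N,$$ where $\|\cdot\|_1$ is the $\ell^1$-norm. An observable is diagonal if $a_N(x,y)=0$ for $x\ne y$, so that $\langle\psi,a_N\psi\rangle=\sum_{x\in\Lambda_N}a_N(x,x)|\psi(x)|^2$. $\Lambda_1=\prod_{l=1}^d\{1,\dots,q_l\}$ is the fundamental block. *)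

theory Defs
  imports "HOL-Analysis.Analysis"
begin

text \<open>
  Points of \<open>Z^d\<close> are vectors of type \<open>int ^ 'd\<close>, with \<open>d = CARD('d) \<ge> 1\<close>.
\<close>

definition lattice_vec :: "int ^ 'd \<Rightarrow> int ^ 'd \<Rightarrow> int ^ 'd" where
  "lattice_vec q n = (\<chi> l. n $ l * q $ l)"

definition period_lattice :: "int ^ 'd \<Rightarrow> (int ^ 'd) set" where
  "period_lattice q = {lattice_vec q n | n. True}"

definition block_shifts :: "int ^ 'd \<Rightarrow> nat \<Rightarrow> (int ^ 'd) set" where
  "block_shifts q N = {lattice_vec q n | n. \<forall>l. n $ l \<in> {0..int N - 1}}"

definition block :: "int ^ 'd \<Rightarrow> nat \<Rightarrow> (int ^ 'd) set" where
  "block q N = {x. \<forall>l. x $ l \<in> {1..q $ l * int N}}"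

definition periodic_potential :: "int ^ 'd \<Rightarrow> (int ^ 'd \<Rightarrow> real) \<Rightarrow> bool" where
  "periodic_potential q V \<longleftrightarrow> (\<forall>x. \<forall>y \<in> period_lattice q. V (x + y) = V x)"

definition norm1 :: "int ^ 'd::finite \<Rightarrow> int" where
  "norm1 x = (\<Sum>l\<in>UNIV. \<bar>x $ l\<bar>)"

text \<open>
  The space \<open>l^2(A)\<close> over a finite set \<open>A\<close>: a function \<open>A \<rightarrow> C\<close> is represented by its
  extension by zero outside \<open>A\<close>, so that equality of representatives is equality on \<open>A\<close>.
\<close>

definition l2_on :: "'a set \<Rightarrow> ('a \<Rightarrow> complex) set" where
  "l2_on A = {\<psi>. \<forall>x. x \<notin> A \<longrightarrow> \<psi> x = 0}"

definition l2_inner :: "'a set \<Rightarrow> ('a \<Rightarrow> complex) \<Rightarrow> ('a \<Rightarrow> complex) \<Rightarrow> complex" where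
  "l2_inner A \<phi> \<psi> = (\<Sum>x\<in>A. cnj (\<phi> x) * \<psi> x)"

definition orthonormal_basis_on ::
    "'a set \<Rightarrow> 'j set \<Rightarrow> ('j \<Rightarrow> 'a \<Rightarrow> complex) \<Rightarrow> bool" where
  "orthonormal_basis_on A J \<psi> \<longleftrightarrow>
     (\<forall>j\<in>J. \<psi> j \<in> l2_on A) \<and>
     (\<forall>i\<in>J. \<forall>j\<in>J. l2_inner A (\<psi> i) (\<psi> j) = (if i = j then 1 else 0)) \<and>
     (\<forall>\<phi>\<in>l2_on A. \<exists>c. \<phi> = (\<lambda>x. \<Sum>j\<in>J. c j * \<psi> j x))"

definition dirichlet_op ::
    "(int ^ 'd::finite) set \<Rightarrow> (int ^ 'd \<Rightarrow> real) \<Rightarrow> (int ^ 'd \<Rightarrow> complex) \<Rightarrow> int ^ 'd \<Rightarrow> complex" where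
  "dirichlet_op A V \<psi> x =
     (if x \<in> A
      then (\<Sum>y\<in>{y\<in>A. norm1 (y - x) = 1}. \<psi> y) + complex_of_real (V x) * \<psi> x
      else 0)"

definition eigenfunction_on ::
    "'a set \<Rightarrow> (('a \<Rightarrow> complex) \<Rightarrow> 'a \<Rightarrow> complex) \<Rightarrow> ('a \<Rightarrow> complex) \<Rightarrow> bool" where
  "eigenfunction_on A H \<psi> \<longleftrightarrow>
     \<psi> \<in> l2_on A \<and> \<psi> \<noteq> (\<lambda>x. 0) \<and> (\<exists>e::complex. H \<psi> = (\<lambda>x. e * \<psi> x))"

text \<open>
  An observable on \<open>A\<close> is a kernel, of which only the values on \<open>A \<times> A\<close> matter.
\<close>

definition kernel_op :: "'a set \<Rightarrow> ('a \<Rightarrow> 'a \<Rightarrow> complex) \<Rightarrow> ('a \<Rightarrow> complex) \<Rightarrow> 'a \<Rightarrow> complex" where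
  "kernel_op A a \<psi> x = (if x \<in> A then \<Sum>y\<in>A. a x y * \<psi> y else 0)"

definition diagonal_on :: "'a set \<Rightarrow> ('a \<Rightarrow> 'a \<Rightarrow> complex) \<Rightarrow> bool" where
  "diagonal_on A a \<longleftrightarrow> (\<forall>x\<in>A. \<forall>y\<in>A. x \<noteq> y \<longrightarrow> a x y = 0)"

definition diag_sup_norm :: "'a set \<Rightarrow> ('a \<Rightarrow> 'a \<Rightarrow> complex) \<Rightarrow> real" where
  "diag_sup_norm A a = (SUP x\<in>A. cmod (a x x))"

definition diag_average :: "'a set \<Rightarrow> ('a \<Rightarrow> 'a \<Rightarrow> complex) \<Rightarrow> complex" where
  "diag_average A a = (\<Sum>x\<in>A. a x x) / of_nat (card A)"

end

theory Submission
  imports Defs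
begin

text \<open>
  With \<open>m $ l = q $ l * N + 1\<close>, expand the eigenfunctions in sine waves with frequencies
  \<open>k $ l / m $ l\<close>. Because the periods are at most 2, \<open>V\<close> is constant on parity classes and the two
  neighbours \<open>x \<plusminus> e_l\<close> lie in the same class, so the sine coefficients at \<open>k\<close>, split by parity class, form an eigenvector of a Floquet matrix
  \<open>h(k)\<close> whose size is independent of \<open>N\<close>. Hence an eigenfunction with nonzero coefficients at both
  \<open>k\<close> and \<open>k'\<close> forces \<open>h(k)\<close> and \<open>h(k')\<close> to share an eigenvalue. Condition (ii) annihilates the
  Fourier coefficients of the centred observable at all \<open>q\<close>-periodic frequencies. For every other
  difference \<open>r\<close> there is a direction \<open>l\<close> such that, on every line in direction \<open>l\<close>, \<open>h(k + r)\<close> and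
  \<open>h(k)\<close> share an eigenvalue at a bounded number of points only: the determinant of
  \<open>h(k + r) \<otimes> 1 - 1 \<otimes> h(k)\<close> is, up to a power of \<open>w = cis (pi * k $ l / m $ l)\<close>, a polynomial in
  \<open>w\<close> of bounded degree that does not vanish at 0. By Cauchy-Schwarz and Parseval the quantum
  variance is \<open>O(1 / N)\<close>.
\<close>

section \<open>Sums over lattice boxes and a quadratic pencil\<close>

definition vec_box :: "('d::finite \<Rightarrow> 'a set) \<Rightarrow> ('a ^ 'd) set" where
  "vec_box S = {x. \<forall>l. x $ l \<in> S l}"

text \<open>Boxes of vectors are images of extensional function spaces, where the distributive law
  for products of sums and the cardinality formula are available.\<close>

lemma bij_betw_vec_box: "bij_betw vec_lambda (PiE UNIV S) (vec_box S)"
  by (rule bij_betwI[where g = vec_nth]) (auto simp: vec_box_def)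

lemma finite_vec_box: "(\<And>l. finite (S l)) \<Longrightarrow> finite (vec_box S)"
  using bij_betw_finite[OF bij_betw_vec_box[of S]] finite_PiE[of UNIV S] by auto

lemma sum_prod_vec_box:
  fixes g :: "'d::finite \<Rightarrow> 'a \<Rightarrow> 'b::comm_semiring_1"
  assumes "\<And>l. finite (S l)"
  shows "(\<Sum>x\<in>vec_box S. \<Prod>l\<in>UNIV. g l (x $ l)) = (\<Prod>l\<in>UNIV. \<Sum>t\<in>S l. g l t)"
  using assms
  by (subst prod_sum_PiE) (auto simp flip: sum.reindex_bij_betw[OF bij_betw_vec_box])

lemma card_vec_box:
  assumes "\<And>l. finite (S l)"
  shows "card (vec_box S) = (\<Prod>l\<in>UNIV. card (S l))"
  using bij_betw_same_card[OF bij_betw_vec_box[of S]] by (simp add: card_PiE)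

text \<open>Translation permutes residue classes: reducing each coordinate modulo its period brings
  the shifted index back into the box, and \<open>g\<close> does not notice.\<close>

lemma sum_periodic_shift:
  fixes p t :: "int ^ 'd::finite" and g :: "int ^ 'd \<Rightarrow> 'b::comm_monoid_add"
  assumes pos: "\<And>l. p $ l > 0"
    and per: "\<And>k k'. (\<And>l. k $ l mod p $ l = k' $ l mod p $ l) \<Longrightarrow> g k = g k'"
  shows "(\<Sum>k\<in>vec_box (\<lambda>l. {0..<p $ l}). g (k + t)) = (\<Sum>k\<in>vec_box (\<lambda>l. {0..<p $ l}). g k)"
proof (rule sum.reindex_bij_witness[where
      i = "\<lambda>k. \<chi> l. (k $ l - t $ l) mod p $ l" and j = "\<lambda>k. \<chi> l. (k $ l + t $ l) mod p $ l"])
  show "g (\<chi> l. (k $ l + t $ l) mod p $ l) = g (k + t)" for k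
    by (rule per) simp
qed (auto simp: vec_box_def vec_eq_iff pos mod_simps)

text \<open>Nonnegative integers with sum 1 are a single 1 and otherwise 0, so neighbours are
  parametrised by a direction and a sign.\<close>

lemma sum_vec_neighbours:
  fixes y :: "int ^ 'd::finite" and g :: "int ^ 'd \<Rightarrow> 'b::comm_monoid_add"
  shows "(\<Sum>x | norm1 (y - x) = 1. g x) = (\<Sum>l\<in>UNIV. g (y + axis l 1) + g (y - axis l 1))"
    and "finite {x. norm1 (y - x) = 1}"
proof -
  let ?I = "UNIV \<times> {1, - 1 :: int}"
  let ?h = "\<lambda>(l, s). y + axis l s"
  have norm: "norm1 (axis l s :: int ^ 'd) = \<bar>s\<bar>" for l s
  proof -
    have "norm1 (axis l s :: int ^ 'd) = (\<Sum>i\<in>UNIV. if i = l then \<bar>s\<bar> else 0)"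
      unfolding norm1_def by (rule sum.cong) (auto simp: axis_def)
    then show ?thesis by simp
  qed
  have minus: "norm1 (y - x) = norm1 (x - y)" for x :: "int ^ 'd"
    by (simp add: norm1_def abs_minus_commute)
  have img: "?h ` ?I = {x. norm1 (y - x) = 1}"
  proof (intro equalityI subsetI)
    fix x assume "x \<in> ?h ` ?I"
    then show "x \<in> {x. norm1 (y - x) = 1}" by (auto simp: minus norm)
  next
    fix x assume "x \<in> {x. norm1 (y - x) = 1}"
    then have 1: "(\<Sum>i\<in>UNIV. \<bar>(x - y) $ i\<bar>) = 1" by (simp add: minus) (simp add: norm1_def)
    then obtain l where l: "(x - y) $ l \<noteq> 0"
      by (metis abs_0 sum.neutral zero_neq_one)
    have split: "\<bar>(x - y) $ l\<bar> + (\<Sum>i\<in>UNIV - {l}. \<bar>(x - y) $ i\<bar>) = 1"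
      using 1 by (subst (asm) sum.remove[of _ l]) auto
    moreover have "(\<Sum>i\<in>UNIV - {l}. \<bar>(x - y) $ i\<bar>) \<ge> 0" by (rule sum_nonneg) simp
    ultimately have s: "\<bar>(x - y) $ l\<bar> = 1" and "(\<Sum>i\<in>UNIV - {l}. \<bar>(x - y) $ i\<bar>) = 0"
      using l by linarith+
    then have z: "(x - y) $ i = 0" if "i \<noteq> l" for i
      using that by (subst (asm) sum_nonneg_eq_0_iff) auto
    have "x = ?h (l, (x - y) $ l)"
      using z by (auto simp: vec_eq_iff axis_def)
    moreover have "(x - y) $ l \<in> {1, - 1}" using s by auto
    ultimately show "x \<in> ?h ` ?I" by blast
  qed
  have inj: "inj_on ?h ?I"
    by (auto simp: inj_on_def vec_eq_iff axis_def split: if_splits)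
  have neg: "axis l (- 1) = - axis l (1 :: int)" for l :: 'd
    by (simp add: vec_eq_iff axis_def)
  have "(\<Sum>x | norm1 (y - x) = 1. g x) = (\<Sum>p\<in>?I. g (?h p))"
    unfolding img[symmetric] by (subst sum.reindex[OF inj]) simp
  also have "\<dots> = (\<Sum>l\<in>UNIV. \<Sum>s\<in>{1, - 1}. g (y + axis l s))"
    by (subst sum.cartesian_product) (auto intro!: sum.cong)
  also have "\<dots> = (\<Sum>l\<in>UNIV. g (y + axis l 1) + g (y - axis l 1))"
    by (simp add: neg)
  finally show "(\<Sum>x | norm1 (y - x) = 1. g x) = (\<Sum>l\<in>UNIV. g (y + axis l 1) + g (y - axis l 1))" .
  show "finite {x. norm1 (y - x) = 1}"
    unfolding img[symmetric] by simp
qed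

text \<open>The determinant of the pencil is a polynomial in \<open>w\<close> whose value at 0 is
  \<open>det A\<close>, nonzero by injectivity. Its degree is at most twice the matrix size, which
  bounds the number of roots.\<close>

lemma quadratic_pencil_singular:
  fixes A B C :: "complex ^ 'n::finite ^ 'n"
  assumes inj: "\<And>u. A *v u = 0 \<Longrightarrow> u = 0"
  shows "finite {w. \<exists>u. u \<noteq> 0 \<and> (\<chi> i j. A $ i $ j + w * B $ i $ j + w ^ 2 * C $ i $ j) *v u = 0}"
    and "card {w. \<exists>u. u \<noteq> 0 \<and> (\<chi> i j. A $ i $ j + w * B $ i $ j + w ^ 2 * C $ i $ j) *v u = 0}
           \<le> 2 * CARD('n)"
proof -
  let ?M = "\<lambda>w. (\<chi> i j. A $ i $ j + w * B $ i $ j + w ^ 2 * C $ i $ j)"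
  let ?W = "{w. \<exists>u. u \<noteq> 0 \<and> ?M w *v u = 0}"
  \<comment> \<open>The pencil becomes one matrix over the polynomial ring, so that its determinant
    is itself the polynomial whose roots are counted.\<close>
  define P :: "complex poly ^ 'n ^ 'n" where
    "P = (\<chi> i j. [:A $ i $ j, B $ i $ j, C $ i $ j:])"
  define D where "D = det P"
  have polyD: "poly D w = det (?M w)" for w
    unfolding D_def det_def P_def
    by (simp add: poly_sum poly_prod power2_eq_square algebra_simps)
  have sing: "det M = 0 \<longleftrightarrow> (\<exists>u. u \<noteq> 0 \<and> M *v u = 0)" for M :: "complex ^ 'n ^ 'n"
    using invertible_det_nz[of M] matrix_left_invertible_ker[of M] invertible_left_inverse[of M] by blast
  have "?M 0 = A" by (simp add: vec_eq_iff)
  then have "poly D 0 \<noteq> 0" using polyD[of 0] sing[of A] inj by auto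
  then have D0: "D \<noteq> 0" by auto
  have "degree D \<le> 2 * CARD('n)"
    unfolding D_def det_def
  proof (rule degree_sum_le)
    fix \<sigma> :: "'n \<Rightarrow> 'n"
    have "degree (of_int (sign \<sigma>) * (\<Prod>i\<in>UNIV. P $ i $ \<sigma> i))
        \<le> degree (of_int (sign \<sigma>) :: complex poly) + degree (\<Prod>i\<in>UNIV. P $ i $ \<sigma> i)"
      by (rule degree_mult_le)
    also have "\<dots> \<le> 0 + (\<Sum>i\<in>UNIV. degree (P $ i $ \<sigma> i))"
      using degree_prod_sum_le[of UNIV "\<lambda>i. P $ i $ \<sigma> i"] by (simp add: o_def)
    also have "\<dots> \<le> (\<Sum>i\<in>(UNIV :: 'n set). 2)"
      unfolding add_0 by (rule sum_mono) (simp add: P_def)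
    finally show "degree (of_int (sign \<sigma>) * (\<Prod>i\<in>UNIV. P $ i $ \<sigma> i)) \<le> 2 * CARD('n)"
      by simp
  qed simp
  moreover have "?W = {w. poly D w = 0}" using polyD sing by auto
  ultimately show "finite ?W" "card ?W \<le> 2 * CARD('n)"
    using poly_roots_finite[OF D0] card_poly_roots_bound[OF D0] by auto
qed

section \<open>Sine and exponential transforms\<close>

definition wave :: "int ^ 'd::finite \<Rightarrow> int ^ 'd \<Rightarrow> int ^ 'd \<Rightarrow> complex" where
  "wave m k x = (\<Prod>l\<in>UNIV. cis (pi * (k $ l * x $ l) / m $ l))"

definition sine :: "int ^ 'd::finite \<Rightarrow> int ^ 'd \<Rightarrow> int ^ 'd \<Rightarrow> complex" where
  "sine m k x = (\<Prod>l\<in>UNIV. complex_of_real (sin (pi * (k $ l * x $ l) / m $ l)))"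

text \<open>A full period in each direction, although the sines at \<open>k\<close> and
  \<open>2 * m - k\<close> agree up to sign: on a full period, frequency shifts act as translations
  of a torus and the exponentials are orthogonal.\<close>

definition freqs :: "int ^ 'd::finite \<Rightarrow> (int ^ 'd) set" where
  "freqs m = vec_box (\<lambda>l. {0..<2 * m $ l})"

definition sites :: "int ^ 'd::finite \<Rightarrow> (int ^ 'd) set" where
  "sites m = vec_box (\<lambda>l. {1..m $ l - 1})"

lemma finite_freqs [simp]: "finite (freqs m)"
  by (simp add: freqs_def finite_vec_box)

lemma finite_sites [simp]: "finite (sites m)"
  by (simp add: sites_def finite_vec_box)

section \<open>Orthogonality of sines and exponentials in one dimension\<close>

lemma cis_period: "cis (pi * (j + 2 * m * c) / m) = cis (pi * j / m)"
  if "m \<noteq> 0" for j m c :: int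
proof -
  have "pi * (j + 2 * m * c) / m = pi * j / m + 2 * pi * of_int c"
    using that by (simp add: field_simps)
  then have "cis (pi * (j + 2 * m * c) / m) = cis (pi * j / m) * cis (2 * pi * of_int c)"
    by (simp only: cis_mult)
  then show ?thesis by (simp add: cis_multiple_2pi)
qed

lemma cis_pi_frac_eq_1_iff: "cis (pi * j / m) = 1 \<longleftrightarrow> 2 * m dvd j" if "m > 0" for j m :: int
proof
  assume "cis (pi * j / m) = 1"
  then have "cos (pi * j / m) = 1" by (simp add: complex_eq_iff)
  then obtain n :: int where "pi * j / m = of_int n * 2 * pi"
    unfolding cos_one_2pi_int by blast
  then have "pi * of_int j = pi * of_int (2 * m * n)" using that by (simp add: field_simps)
  then have "j = 2 * m * n" by (simp only: mult_cancel_left pi_neq_zero of_int_eq_iff simp_thms)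
  then show "2 * m dvd j" by simp
next
  assume "2 * m dvd j"
  then obtain n where "j = 2 * m * n" by blast
  then show "cis (pi * j / m) = 1" using cis_period[of m 0 n] that by simp
qed

lemma sum_cis_frac:
  fixes j m :: int
  assumes "m > 0"
  shows "(\<Sum>k\<in>{0..<2 * m}. cis (pi * (k * j) / m)) = (if 2 * m dvd j then of_int (2 * m) else 0)"
proof -
  let ?z = "cis (pi * j / m)"
  have "(\<Sum>k\<in>{0..<2 * m}. cis (pi * (k * j) / m)) = (\<Sum>k<nat (2 * m). ?z ^ k)"
    by (rule sum.reindex_bij_witness[where i = int and j = nat])
       (auto simp: Complex.DeMoivre mult_ac)
  moreover have "?z ^ nat (2 * m) = cis (pi * (2 * m * j) / m)"
    using assms by (simp add: Complex.DeMoivre mult_ac)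
  moreover have "cis (pi * (2 * m * j) / m) = 1"
    using cis_period[of m 0 j] assms by simp
  ultimately show ?thesis
    using cis_pi_frac_eq_1_iff[OF assms, of j] assms by (auto simp: geometric_sum)
qed

text \<open>Sums of two site coordinates lie strictly between 0 and \<open>2 * m\<close>,
  differences strictly between \<open>- m\<close> and \<open>m\<close>.\<close>

lemma not_dvd_lattice:
  fixes x y m :: int
  assumes "x \<in> {1..m - 1}" "y \<in> {1..m - 1}"
  shows "2 * m dvd x - y \<longleftrightarrow> x = y" "\<not> 2 * m dvd x + y"
proof -
  show "\<not> 2 * m dvd x + y" using assms zdvd_imp_le[of "2 * m" "x + y"] by auto
  have "\<not> 2 * m dvd x - y" if "x \<noteq> y"
  proof (cases "x > y")
    case True
    then show ?thesis using assms zdvd_imp_le[of "2 * m" "x - y"] by auto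
  next
    case False
    then show ?thesis using assms that zdvd_imp_le[of "2 * m" "y - x"]
      by (auto simp: dvd_diff_commute)
  qed
  then show "2 * m dvd x - y \<longleftrightarrow> x = y" by auto
qed

lemma sin_conv_cis: "complex_of_real (sin t) = (cis t - cis (- t)) / (2 * \<i>)"
  by (simp add: complex_eq_iff)

text \<open>Expanding the sine gives character sums at \<open>x + y\<close> and
  \<open>y - x\<close>. The first always vanishes; the second survives only for \<open>x = y\<close>
  and contributes \<open>- 2 * m / (2 * \<i>)\<close>, which is \<open>\<i> * m\<close>.\<close>

lemma sum_sin_cis:
  fixes x y m :: int
  assumes "x \<in> {1..m - 1}" "y \<in> {1..m - 1}"
  shows "(\<Sum>k\<in>{0..<2 * m}. complex_of_real (sin (pi * (k * x) / m)) * cis (pi * (k * y) / m))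
       = (if x = y then \<i> * of_int m else 0)"
proof -
  have m: "m > 0" using assms by auto
  have "(\<Sum>k\<in>{0..<2 * m}. complex_of_real (sin (pi * (k * x) / m)) * cis (pi * (k * y) / m))
      = (\<Sum>k\<in>{0..<2 * m}. (cis (pi * (k * (x + y)) / m) - cis (pi * (k * (y - x)) / m)) / (2 * \<i>))"
    by (rule sum.cong)
       (simp_all add: sin_conv_cis left_diff_distrib cis_mult add_divide_distrib diff_divide_distrib
          algebra_simps)
  also have "\<dots> = (if x = y then \<i> * of_int m else 0)"
    unfolding sum_divide_distrib[symmetric] sum_subtractf sum_cis_frac[OF m]
    using not_dvd_lattice[OF assms(2,1)] not_dvd_lattice(2)[OF assms]
    by (auto simp: field_simps)
  finally show ?thesis .
qed

lemma sum_sin_sin: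
  fixes x y m :: int
  assumes "x \<in> {1..m - 1}" "y \<in> {1..m - 1}"
  shows "(\<Sum>k\<in>{0..<2 * m}. complex_of_real (sin (pi * (k * x) / m)) * complex_of_real (sin (pi * (k * y) / m)))
       = (if x = y then of_int m else 0)"
proof -
  let ?s = "\<Sum>k\<in>{0..<2 * m}. complex_of_real (sin (pi * (k * x) / m)) * cis (pi * (k * y) / m)"
  have "(\<Sum>k\<in>{0..<2 * m}. complex_of_real (sin (pi * (k * x) / m)) * complex_of_real (sin (pi * (k * y) / m)))
      = complex_of_real (Im ?s)"
    by simp
  also have "\<dots> = (if x = y then of_int m else 0)"
    unfolding sum_sin_cis[OF assms] by simp
  finally show ?thesis .
qed

section \<open>Orthogonality and Parseval in several dimensions\<close>

lemma prod_if_all: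
  "(\<Prod>l\<in>UNIV. if P l then c l else 0) = (if \<forall>l. P l then \<Prod>l\<in>UNIV. c l else 0)"
  for c :: "'d::finite \<Rightarrow> complex"
  by (auto intro: prod_zero)

text \<open>This allows sine coefficients to be resynthesised with exponentials instead of sines.
  Products of exponentials are again exponentials, so quadratic expressions in a function involve
  only differences of frequencies.\<close>

lemma sum_sine_wave:
  assumes "x \<in> sites m" "y \<in> sites m"
  shows "(\<Sum>k\<in>freqs m. sine m k x * wave m k y)
       = (if x = y then (\<Prod>l\<in>UNIV. \<i> * of_int (m $ l)) else 0)"
proof -
  have "(\<Sum>k\<in>freqs m. sine m k x * wave m k y)
      = (\<Sum>k\<in>freqs m. \<Prod>l\<in>UNIV. complex_of_real (sin (pi * (k $ l * x $ l) / m $ l)) * cis (pi * (k $ l * y $ l) / m $ l))"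
    by (simp add: sine_def wave_def prod.distrib)
  also have "\<dots> = (\<Prod>l\<in>UNIV. \<Sum>k\<in>{0..<2 * m $ l}.
      complex_of_real (sin (pi * (k * x $ l) / m $ l)) * cis (pi * (k * y $ l) / m $ l))"
    unfolding freqs_def
    by (rule sum_prod_vec_box[where g = "\<lambda>l k. complex_of_real (sin (pi * (k * x $ l) / m $ l)) * cis (pi * (k * y $ l) / m $ l)"]) simp
  also have "\<dots> = (\<Prod>l\<in>UNIV. if x $ l = y $ l then \<i> * of_int (m $ l) else 0)"
    using assms by (intro prod.cong refl sum_sin_cis) (simp_all add: sites_def vec_box_def)
  finally show ?thesis by (simp add: prod_if_all vec_eq_iff)
qed

lemma sum_sine_sine:
  assumes "x \<in> sites m" "y \<in> sites m"
  shows "(\<Sum>k\<in>freqs m. sine m k x * sine m k y)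
       = (if x = y then (\<Prod>l\<in>UNIV. of_int (m $ l)) else 0)"
proof -
  have "(\<Sum>k\<in>freqs m. sine m k x * sine m k y)
      = (\<Sum>k\<in>freqs m. \<Prod>l\<in>UNIV. complex_of_real (sin (pi * (k $ l * x $ l) / m $ l)) * complex_of_real (sin (pi * (k $ l * y $ l) / m $ l)))"
    by (simp add: sine_def wave_def prod.distrib)
  also have "\<dots> = (\<Prod>l\<in>UNIV. \<Sum>k\<in>{0..<2 * m $ l}.
      complex_of_real (sin (pi * (k * x $ l) / m $ l)) * complex_of_real (sin (pi * (k * y $ l) / m $ l)))"
    unfolding freqs_def
    by (rule sum_prod_vec_box[where g = "\<lambda>l k. complex_of_real (sin (pi * (k * x $ l) / m $ l)) * complex_of_real (sin (pi * (k * y $ l) / m $ l))"]) simp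
  also have "\<dots> = (\<Prod>l\<in>UNIV. if x $ l = y $ l then of_int (m $ l) else 0)"
    using assms by (intro prod.cong refl sum_sin_sin) (simp_all add: sites_def vec_box_def)
  finally show ?thesis by (simp add: prod_if_all vec_eq_iff)
qed

lemma cnj_wave: "cnj (wave m k x) = wave m (- k) x"
  by (simp add: wave_def cis_cnj)

lemma wave_add_left: "wave m (k + k') x = wave m k x * wave m k' x"
  by (simp add: wave_def cis_mult add_divide_distrib algebra_simps flip: prod.distrib)

lemma wave_add_right: "wave m k (x + y) = wave m k x * wave m k y"
  by (simp add: wave_def cis_mult add_divide_distrib algebra_simps flip: prod.distrib)

lemma wave_commute: "wave m k x = wave m x k"
  by (simp add: wave_def mult.commute)

lemma cis_frac_mod:
  fixes k k' m x :: int
  assumes "m > 0" "k mod (2 * m) = k' mod (2 * m)"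
  shows "cis (pi * (k * x) / m) = cis (pi * (k' * x) / m)"
proof -
  have "2 * m dvd k - k'" using assms(2) by (simp add: mod_eq_dvd_iff)
  then obtain c where c: "k = k' + 2 * m * c" by (metis add.commute diff_add_cancel dvdE)
  have "k * x = k' * x + 2 * m * (c * x)" by (simp add: c algebra_simps)
  then show ?thesis using cis_period[of m "k' * x" "c * x"] assms(1) by simp
qed

lemma wave_mod:
  assumes "\<And>l. m $ l > 0" "\<And>l. k $ l mod (2 * m $ l) = k' $ l mod (2 * m $ l)"
  shows "wave m k x = wave m k' x"
  unfolding wave_def by (intro prod.cong refl cis_frac_mod assms)

lemma sum_wave_cnj_wave:
  assumes "x \<in> sites m" "y \<in> sites m"
  shows "(\<Sum>k\<in>freqs m. wave m k x * cnj (wave m k y)) = (if x = y then of_nat (card (freqs m)) else 0)"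
proof -
  have pos: "m $ l > 0" for l
    using spec[of _ l] assms(1) unfolding sites_def vec_box_def by (smt (verit) atLeastAtMost_iff mem_Collect_eq)
  have "(\<Sum>k\<in>freqs m. wave m k x * cnj (wave m k y)) = (\<Sum>k\<in>freqs m. wave m (x - y) k)"
    by (simp add: cnj_wave wave_commute[of m _ x] wave_commute[of m _ y] flip: wave_add_left)
  also have "\<dots> = (\<Prod>l\<in>UNIV. \<Sum>k\<in>{0..<2 * m $ l}. cis (pi * (k * (x $ l - y $ l)) / m $ l))"
    unfolding freqs_def wave_def
    by (subst sum_prod_vec_box[symmetric]) (auto simp: mult.commute)
  also have "\<dots> = (\<Prod>l\<in>UNIV. if x $ l = y $ l then of_int (2 * m $ l) else 0)"
    using assms not_dvd_lattice(1)
    by (intro prod.cong refl) (subst sum_cis_frac[OF pos], auto simp: sites_def vec_box_def)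
  also have "\<dots> = (if x = y then of_nat (card (freqs m)) else 0)"
    using pos by (auto simp: prod_if_all vec_eq_iff freqs_def card_vec_box less_imp_le intro!: prod.cong)
  finally show ?thesis .
qed

text \<open>After the square is expanded, orthogonality over the full frequency period leaves only
  the diagonal pairs of sites.\<close>

lemma parseval_wave:
  "(\<Sum>k\<in>freqs m. (cmod (\<Sum>x\<in>sites m. \<alpha> x * wave m k x))\<^sup>2)
     = card (freqs m) * (\<Sum>x\<in>sites m. (cmod (\<alpha> x))\<^sup>2)"
proof -
  have "complex_of_real (\<Sum>k\<in>freqs m. (cmod (\<Sum>x\<in>sites m. \<alpha> x * wave m k x))\<^sup>2)
      = (\<Sum>k\<in>freqs m. \<Sum>x\<in>sites m. \<Sum>y\<in>sites m. \<alpha> x * cnj (\<alpha> y) * (wave m k x * cnj (wave m k y)))"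
    unfolding of_real_sum complex_norm_square by (simp add: sum_product mult_ac)
  also have "\<dots> = (\<Sum>x\<in>sites m. \<Sum>y\<in>sites m. \<alpha> x * cnj (\<alpha> y) * (\<Sum>k\<in>freqs m. wave m k x * cnj (wave m k y)))"
    by (subst sum.swap, rule sum.cong[OF refl], subst sum.swap) (simp add: sum_distrib_left)
  also have "\<dots> = (\<Sum>x\<in>sites m. \<Sum>y\<in>sites m. if x = y then \<alpha> x * cnj (\<alpha> y) * of_nat (card (freqs m)) else 0)"
    by (intro sum.cong refl) (simp add: sum_wave_cnj_wave)
  also have "\<dots> = complex_of_real (card (freqs m) * (\<Sum>x\<in>sites m. (cmod (\<alpha> x))\<^sup>2))"
    unfolding of_real_mult of_real_sum complex_norm_square by (simp add: sum_distrib_left mult_ac)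
  finally show ?thesis by (simp only: of_real_eq_iff)
qed

section \<open>The Floquet matrix and common eigenvalues\<close>

text \<open>For periods 1 and 2 this encodes the residue of \<open>x\<close> modulo the period
  lattice, as the set of period-2 directions with odd coordinate. The index type
  \<open>'d set\<close> is finite and independent of the box.\<close>

definition parity_class :: "int ^ 'd::finite \<Rightarrow> int ^ 'd \<Rightarrow> 'd set" where
  "parity_class q x = {l. q $ l \<noteq> 1 \<and> odd (x $ l)}"

definition flip_parity :: "int ^ 'd::finite \<Rightarrow> 'd \<Rightarrow> 'd set \<Rightarrow> 'd set" where
  "flip_parity q l c = (if q $ l = 1 then c else if l \<in> c then c - {l} else insert l c)"

lemma flip_parity_flip [simp]: "flip_parity q l (flip_parity q l c) = c"
  by (auto simp: flip_parity_def)

lemma flip_parity_eq_iff: "flip_parity q l c = c' \<longleftrightarrow> c = flip_parity q l c'"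
  by (metis flip_parity_flip)

text \<open>The two neighbours along a direction differ by 2 and hence have the same parity. Modulo
  a period larger than 2 they would have different residues.\<close>

lemma parity_class_shift:
  "parity_class q (x + axis l 1) = flip_parity q l (parity_class q x)"
  "parity_class q (x - axis l 1) = flip_parity q l (parity_class q x)"
  by (auto simp: parity_class_def flip_parity_def axis_def split: if_splits)

text \<open>
  The Floquet matrix at frequency \<open>k\<close>: the action of the Hamiltonian on the sine coefficients at \<open>k\<close>
  of the restrictions of a function to the parity classes.
\<close>

definition bloch ::
    "int ^ 'd::finite \<Rightarrow> ('d set \<Rightarrow> complex) \<Rightarrow> int ^ 'd \<Rightarrow> int ^ 'd \<Rightarrow> ('d set \<Rightarrow> complex) \<Rightarrow> 'd set \<Rightarrow> complex" where
  "bloch q v m k F c =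
     v c * F c + (\<Sum>l\<in>UNIV. complex_of_real (2 * cos (pi * k $ l / m $ l)) * F (flip_parity q l c))"

definition common_eigenvalue ::
    "int ^ 'd::finite \<Rightarrow> ('d set \<Rightarrow> complex) \<Rightarrow> int ^ 'd \<Rightarrow> int ^ 'd \<Rightarrow> int ^ 'd \<Rightarrow> bool" where
  "common_eigenvalue q v m k k' \<longleftrightarrow> (\<exists>E F G. F \<noteq> (\<lambda>c. 0) \<and> G \<noteq> (\<lambda>c. 0) \<and>
     bloch q v m k F = (\<lambda>c. E * F c) \<and> bloch q v m k' G = (\<lambda>c. E * G c))"

section \<open>Sine coefficients of Dirichlet eigenfunctions\<close>

lemma sine_eq_0: "sine m k x = 0" if "m $ l > 0" "x $ l = 0 \<or> x $ l = m $ l"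
proof -
  have "sin (pi * (k $ l * x $ l) / m $ l) = 0"
    using that by (auto simp: field_simps)
  then show ?thesis unfolding sine_def by (intro prod_zero) (auto intro!: bexI[of _ l])
qed

lemma sine_neighbours:
  "sine m k (y + axis l 1) + sine m k (y - axis l 1)
     = complex_of_real (2 * cos (pi * k $ l / m $ l)) * sine m k y"
proof -
  let ?g = "\<lambda>x i. complex_of_real (sin (pi * (k $ i * x $ i) / m $ i))"
  have split: "sine m k x = ?g x l * (\<Prod>i\<in>UNIV - {l}. ?g x i)" for x
    unfolding sine_def by (rule prod.remove) auto
  have "(\<Prod>i\<in>UNIV - {l}. ?g (y + s) i) = (\<Prod>i\<in>UNIV - {l}. ?g y i)"
    "(\<Prod>i\<in>UNIV - {l}. ?g (y - s) i) = (\<Prod>i\<in>UNIV - {l}. ?g y i)" if "s = axis l 1" for s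
    by (rule prod.cong; simp add: that axis_def)+
  moreover have "?g (y + axis l 1) l + ?g (y - axis l 1) l
      = complex_of_real (2 * cos (pi * k $ l / m $ l)) * ?g y l"
  proof -
    let ?a = "pi * (k $ l * y $ l) / m $ l" and ?b = "pi * k $ l / m $ l"
    have "pi * (k $ l * (y $ l + 1)) / m $ l = ?a + ?b" "pi * (k $ l * (y $ l - 1)) / m $ l = ?a - ?b"
      by (simp_all add: add_divide_distrib diff_divide_distrib algebra_simps)
    then have "sin (pi * (k $ l * (y $ l + 1)) / m $ l) + sin (pi * (k $ l * (y $ l - 1)) / m $ l)
        = 2 * cos ?b * sin ?a"
      by (simp only: sin_add sin_diff) (simp add: algebra_simps)
    then show ?thesis by (simp flip: of_real_add of_real_mult)
  qed
  ultimately show ?thesis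
    by (simp add: split[of "y + axis l 1"] split[of "y - axis l 1"] split[of y]
        flip: distrib_right mult.assoc)
qed

text \<open>A neighbour outside the box lies on a face \<open>x $ l = 0\<close> or
  \<open>x $ l = m $ l\<close>, where the sine vanishes, so the truncation may be dropped. The two
  neighbours along each direction share a parity class and combine by the addition formula.\<close>

lemma sum_dirichlet_neighbours:
  fixes m y :: "int ^ 'd::finite"
  assumes y: "y \<in> sites m"
  shows "(\<Sum>x | x \<in> sites m \<and> norm1 (y - x) = 1. if parity_class q x = c then sine m k x else 0)
       = (\<Sum>l\<in>UNIV. if parity_class q y = flip_parity q l c
            then complex_of_real (2 * cos (pi * k $ l / m $ l)) * sine m k y else 0)"
proof -
  have y': "1 \<le> y $ l \<and> y $ l \<le> m $ l - 1" for l
    using y by (simp add: sites_def vec_box_def)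
  have out: "sine m k x = 0" if "norm1 (y - x) = 1" and x: "x \<notin> sites m" for x
  proof -
    obtain l where l: "\<not> (1 \<le> x $ l \<and> x $ l \<le> m $ l - 1)"
      using x by (auto simp: sites_def vec_box_def)
    have "\<bar>(y - x) $ l\<bar> \<le> norm1 (y - x)"
      unfolding norm1_def by (rule member_le_sum) auto
    then have "\<bar>y $ l - x $ l\<bar> \<le> 1" using \<open>norm1 (y - x) = 1\<close> by simp
    then have "x $ l = 0 \<or> x $ l = m $ l" "m $ l > 0" using l y'[of l] by auto
    then show ?thesis by (intro sine_eq_0)
  qed
  have "(\<Sum>x | x \<in> sites m \<and> norm1 (y - x) = 1. if parity_class q x = c then sine m k x else 0)
      = (\<Sum>x | norm1 (y - x) = 1. if parity_class q x = c then sine m k x else 0)"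
  proof (intro sum.mono_neutral_left ballI)
    fix x assume "x \<in> {x. norm1 (y - x) = 1} - {x \<in> sites m. norm1 (y - x) = 1}"
    then show "(if parity_class q x = c then sine m k x else 0) = 0" using out[of x] by auto
  qed (auto simp: sum_vec_neighbours(2))
  also have "\<dots> = (\<Sum>l\<in>UNIV. if parity_class q y = flip_parity q l c
      then sine m k (y + axis l 1) + sine m k (y - axis l 1) else 0)"
    unfolding sum_vec_neighbours(1)
    by (rule sum.cong) (auto simp: parity_class_shift flip_parity_eq_iff)
  finally show ?thesis unfolding sine_neighbours .
qed

definition fibre ::
    "int ^ 'd::finite \<Rightarrow> int ^ 'd \<Rightarrow> (int ^ 'd \<Rightarrow> complex) \<Rightarrow> int ^ 'd \<Rightarrow> 'd set \<Rightarrow> complex" where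
  "fibre q m \<psi> k c = (\<Sum>x\<in>sites m. if parity_class q x = c then \<psi> x * sine m k x else 0)"

lemma sum_fibre: "(\<Sum>c\<in>UNIV. fibre q m \<psi> k c) = (\<Sum>x\<in>sites m. \<psi> x * sine m k x)"
  unfolding fibre_def by (subst sum.swap) simp

text \<open>The eigenvalue equation is tested against the sine restricted to one parity class. The
  potential is constant there, and hopping turns that test function into sines on the flipped
  classes.\<close>

lemma bloch_fibre:
  assumes eig: "dirichlet_op (sites m) V \<psi> = (\<lambda>x. E * \<psi> x)"
    and V: "\<And>x. complex_of_real (V x) = v (parity_class q x)"
  shows "bloch q v m k (fibre q m \<psi> k) = (\<lambda>c. E * fibre q m \<psi> k c)"
proof
  fix c
  let ?s = "\<lambda>x. if parity_class q x = c then sine m k x else 0"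
  have sym: "norm1 (y - x) = norm1 (x - y)" for x y :: "int ^ 'a"
    by (simp add: norm1_def abs_minus_commute)
  have "E * fibre q m \<psi> k c = (\<Sum>x\<in>sites m. dirichlet_op (sites m) V \<psi> x * ?s x)"
    unfolding eig fibre_def sum_distrib_left by (rule sum.cong) auto
  also have "\<dots> = (\<Sum>x\<in>sites m. (\<Sum>y | y \<in> sites m \<and> norm1 (y - x) = 1. \<psi> y * ?s x))
      + (\<Sum>x\<in>sites m. complex_of_real (V x) * \<psi> x * ?s x)"
    unfolding sum.distrib[symmetric]
    by (rule sum.cong) (simp_all add: dirichlet_op_def distrib_right sum_distrib_right del: mult_cancel_right1)
  also have "(\<Sum>x\<in>sites m. complex_of_real (V x) * \<psi> x * ?s x) = v c * fibre q m \<psi> k c"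
    unfolding fibre_def sum_distrib_left by (rule sum.cong) (auto simp: V)
  \<comment> \<open>Symmetry of the neighbour relation moves the hopping from \<open>\<psi>\<close>
    onto the restricted sine.\<close>
  also have "(\<Sum>x\<in>sites m. (\<Sum>y | y \<in> sites m \<and> norm1 (y - x) = 1. \<psi> y * ?s x))
      = (\<Sum>y\<in>sites m. \<psi> y * (\<Sum>x | x \<in> sites m \<and> norm1 (y - x) = 1. ?s x))"
    unfolding sum_distrib_left by (rule sum.swap_restrict) auto
  also have "\<dots> = (\<Sum>y\<in>sites m. \<psi> y * (\<Sum>l\<in>UNIV. if parity_class q y = flip_parity q l c
            then complex_of_real (2 * cos (pi * k $ l / m $ l)) * sine m k y else 0))"
    by (intro sum.cong refl) (simp add: sum_dirichlet_neighbours)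
  also have "\<dots> = (\<Sum>l\<in>UNIV. complex_of_real (2 * cos (pi * k $ l / m $ l)) * fibre q m \<psi> k (flip_parity q l c))"
    unfolding fibre_def sum_distrib_left by (subst sum.swap) (auto intro!: sum.cong)
  finally show "bloch q v m k (fibre q m \<psi> k) c = E * fibre q m \<psi> k c"
    by (simp add: bloch_def)
qed

text \<open>The entries of a fibre add up to the sine coefficient, so a nonzero coefficient makes
  the fibre a genuine eigenvector. The same \<open>E\<close> occurs at both frequencies.\<close>

lemma common_eigenvalueI:
  assumes eig: "dirichlet_op (sites m) V \<psi> = (\<lambda>x. E * \<psi> x)"
    and V: "\<And>x. complex_of_real (V x) = v (parity_class q x)"
    and "(\<Sum>x\<in>sites m. \<psi> x * sine m k x) \<noteq> 0" "(\<Sum>x\<in>sites m. \<psi> x * sine m k' x) \<noteq> 0"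
  shows "common_eigenvalue q v m k k'"
  unfolding common_eigenvalue_def
proof (intro exI conjI)
  have "fibre q m \<psi> k \<noteq> (\<lambda>c. 0)" if "(\<Sum>x\<in>sites m. \<psi> x * sine m k x) \<noteq> 0" for k
  proof
    assume "fibre q m \<psi> k = (\<lambda>c. 0)"
    then show False using that sum_fibre[of q m \<psi> k] by simp
  qed
  then show "fibre q m \<psi> k \<noteq> (\<lambda>c. 0)" "fibre q m \<psi> k' \<noteq> (\<lambda>c. 0)" using assms(3,4) by blast+
qed (rule bloch_fibre[OF eig V])+

section \<open>Frequencies with a common eigenvalue on a line\<close>

lemma cos_conv_cis: "complex_of_real (2 * cos t) = cis t + cis (- t)"
  by (simp add: complex_eq_iff)

lemma common_eigenvalue_cong:
  assumes "\<And>l. cos (pi * k $ l / m $ l) = cos (pi * k1 $ l / m $ l)"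
    "\<And>l. cos (pi * k' $ l / m $ l) = cos (pi * k1' $ l / m $ l)"
  shows "common_eigenvalue q v m k k' \<longleftrightarrow> common_eigenvalue q v m k1 k1'"
  unfolding common_eigenvalue_def bloch_def assms ..

text \<open>
  Multiplied by \<open>w = cis (pi * (k $ l + t) / m $ l)\<close>, the operator \<open>h(k + t e_l + r) \<otimes> 1 - 1 \<otimes> h(k + t e_l)\<close>
  is a quadratic pencil in \<open>w\<close> whose constant term only involves the flip in direction \<open>l\<close>.
\<close>

lemma card_common_eigenvalue_line:
  fixes q m k r :: "int ^ 'd::finite"
  assumes ql: "q $ l \<in> {1, 2}" and ml: "m $ l > 0"
    and r: "cis (pi * (r $ l * q $ l) / m $ l) \<noteq> 1"
  shows "card {t \<in> {0..<2 * m $ l}. common_eigenvalue q v m (k + axis l t + r) (k + axis l t)}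
       \<le> 2 * CARD('d set \<times> 'd set)"
proof -
  \<comment> \<open>\<open>z\<close> is the phase that \<open>r\<close> adds in direction
    \<open>l\<close>. \<open>h\<close> is the Floquet matrix without direction \<open>l\<close>,
    hence constant along the line; \<open>A\<close>, \<open>B\<close>, \<open>C\<close> collect the
    powers 0, 1, 2 of \<open>w\<close> in the pencil.\<close>
  define z where "z = cis (pi * r $ l / m $ l)"
  define e where "e = (\<lambda>j :: int. complex_of_real (2 * cos (pi * j / m $ l)))"
  define \<delta> :: "'d set \<Rightarrow> 'd set \<Rightarrow> complex" where "\<delta> = (\<lambda>b c. if b = c then 1 else 0)"
  define h where "h = (\<lambda>(k :: int ^ 'd) c b. v c * \<delta> b c +
      (\<Sum>i\<in>UNIV - {l}. complex_of_real (2 * cos (pi * k $ i / m $ i)) * \<delta> b (flip_parity q i c)))"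
  define A :: "complex ^ ('d set \<times> 'd set) ^ ('d set \<times> 'd set)" where
    "A = (\<chi> p s. cnj z * \<delta> (fst s) (flip_parity q l (fst p)) * \<delta> (snd s) (snd p)
            - \<delta> (fst s) (fst p) * \<delta> (snd s) (flip_parity q l (snd p)))"
  define C :: "complex ^ ('d set \<times> 'd set) ^ ('d set \<times> 'd set)" where
    "C = (\<chi> p s. z * \<delta> (fst s) (flip_parity q l (fst p)) * \<delta> (snd s) (snd p)
            - \<delta> (fst s) (fst p) * \<delta> (snd s) (flip_parity q l (snd p)))"
  define B :: "complex ^ ('d set \<times> 'd set) ^ ('d set \<times> 'd set)" where
    "B = (\<chi> p s. h (k + r) (fst p) (fst s) * \<delta> (snd s) (snd p)
            - \<delta> (fst s) (fst p) * h k (snd p) (snd s))"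
  let ?W = "{w. \<exists>u. u \<noteq> 0 \<and> (\<chi> i j. A $ i $ j + w * B $ i $ j + w ^ 2 * C $ i $ j) *v u = 0}"
  let ?w = "\<lambda>t. cis (pi * (k $ l + t) / m $ l)"
  have sum_pair: "(\<Sum>s\<in>UNIV. X (fst s) * Y (snd s)) = (\<Sum>b\<in>UNIV. X b) * (\<Sum>b\<in>UNIV. Y b)"
    for X Y :: "'d set \<Rightarrow> complex"
    by (simp only: sum_product sum.cartesian_product UNIV_Times_UNIV split_def)
  have sum_\<delta>: "(\<Sum>b\<in>UNIV. \<delta> b c * F b) = F c" for c and F :: "'d set \<Rightarrow> complex"
  proof -
    have "(\<Sum>b\<in>UNIV. \<delta> b c * F b) = (\<Sum>b\<in>UNIV. if b = c then F b else 0)"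
      by (rule sum.cong) (auto simp: \<delta>_def)
    then show ?thesis by simp
  qed
  have \<delta>_pair: "\<delta> (fst s) b * \<delta> (snd s) c = (if s = (b, c) then 1 else 0)" for s b c
    by (cases s) (simp add: \<delta>_def)
  \<comment> \<open>A kernel vector satisfies a relation that trades a flip of one index for a flip
    of the other at the cost of \<open>cnj z\<close>. If \<open>q $ l = 1\<close> flips are trivial
    and one use suffices; otherwise two uses return to the start. Since \<open>z\<close> to the
    power \<open>q $ l\<close> is not 1, the vector vanishes.\<close>
  have A_inj: "u = 0" if "A *v u = 0" for u
  proof -
    have rel: "u $ (b, flip_parity q l c) = cnj z * u $ (flip_parity q l b, c)" for b c
    proof -
      have "0 = (A *v u) $ (b, c)" using that by simp
      also have "\<dots> = (\<Sum>s\<in>UNIV. (if s = (flip_parity q l b, c) then cnj z * u $ s else 0)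
            - (if s = (b, flip_parity q l c) then u $ s else 0))"
        unfolding matrix_vector_mult_def A_def vec_lambda_beta
        by (rule sum.cong[OF refl], simp only: mult.assoc \<delta>_pair fst_conv snd_conv) (simp add: left_diff_distrib)
      finally show ?thesis unfolding sum_subtractf by simp
    qed
    have "u $ (b, c) = 0" for b c
    proof (cases "q $ l = 1")
      case True
      then have "z \<noteq> 1" using r by (simp add: z_def)
      then have "cnj z \<noteq> 1" by (metis complex_cnj_one_iff)
      moreover have "u $ (b, c) = cnj z * u $ (b, c)" using rel[of b c] True by (simp add: flip_parity_def)
      ultimately show ?thesis by simp
    next
      case False
      then have "z ^ 2 \<noteq> 1" using r ql by (simp add: z_def Complex.DeMoivre mult_ac)
      then have "cnj z ^ 2 \<noteq> 1" by (metis complex_cnj_one_iff complex_cnj_power)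
      moreover have "u $ (b, c) = cnj z ^ 2 * u $ (b, c)"
        using rel[of b "flip_parity q l c"] rel[of "flip_parity q l b" c] by (simp add: power2_eq_square)
      ultimately show ?thesis by simp
    qed
    then show ?thesis by (simp add: vec_eq_iff)
  qed
  have pencil: "finite ?W" "card ?W \<le> 2 * CARD('d set \<times> 'd set)"
    using quadratic_pencil_singular[of A B C] A_inj by blast+
  have mem: "?w t \<in> ?W" if ce: "common_eigenvalue q v m (k + axis l t + r) (k + axis l t)" for t
  proof -
    obtain E F G where FG: "F \<noteq> (\<lambda>c. 0)" "G \<noteq> (\<lambda>c. 0)"
      and F: "\<And>c. bloch q v m (k + axis l t + r) F c = E * F c"
      and G: "\<And>c. bloch q v m (k + axis l t) G c = E * G c"
      using ce unfolding common_eigenvalue_def fun_eq_iff by blast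
    \<comment> \<open>The tensor product of the two eigenvectors is annihilated by the Kronecker
      difference, because their eigenvalues cancel.\<close>
    define u :: "complex ^ ('d set \<times> 'd set)" where "u = (\<chi> s. F (fst s) * G (snd s))"
    have "u \<noteq> 0"
    proof -
      obtain b c where "F b \<noteq> 0" "G c \<noteq> 0" using FG unfolding fun_eq_iff by blast
      then have "u $ (b, c) \<noteq> 0" by (simp add: u_def)
      then show ?thesis by auto
    qed
    have bl: "bloch q v m (k' + axis l t) F c = (\<Sum>b\<in>UNIV. h k' c b * F b) + e (k' $ l + t) * F (flip_parity q l c)"
      for k' F c
    proof -
      have "(\<Sum>b\<in>UNIV. h k' c b * F b) = v c * (\<Sum>b\<in>UNIV. \<delta> b c * F b)
          + (\<Sum>i\<in>UNIV - {l}. complex_of_real (2 * cos (pi * k' $ i / m $ i)) * (\<Sum>b\<in>UNIV. \<delta> b (flip_parity q i c) * F b))"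
        unfolding h_def distrib_right sum.distrib sum_distrib_right sum_distrib_left
        by (subst sum.swap) (simp only: mult.assoc)
      moreover have "(\<Sum>i\<in>UNIV. complex_of_real (2 * cos (pi * (k' + axis l t) $ i / m $ i)) * F (flip_parity q i c))
         = e (k' $ l + t) * F (flip_parity q l c)
          + (\<Sum>i\<in>UNIV - {l}. complex_of_real (2 * cos (pi * k' $ i / m $ i)) * F (flip_parity q i c))"
        by (subst sum.remove[of _ l]) (auto simp: e_def axis_def intro!: sum.cong)
      ultimately show ?thesis unfolding bloch_def sum_\<delta> by simp
    qed
    \<comment> \<open>Twice the cosine is \<open>w\<close> plus its inverse, so multiplication by
      \<open>w\<close> clears the negative power.\<close>
    have we: "?w t * e (k $ l + t) = 1 + (?w t)\<^sup>2"
      unfolding e_def cos_conv_cis by (simp add: distrib_left cis_mult power2_eq_square)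
    have we': "?w t * e (k $ l + r $ l + t) = cnj z + z * (?w t)\<^sup>2"
    proof -
      have "pi * (k $ l + r $ l + t) / m $ l = pi * (k $ l + t) / m $ l + pi * r $ l / m $ l"
        by (simp add: algebra_simps add_divide_distrib)
      then show ?thesis
        unfolding e_def cos_conv_cis z_def
        by (simp add: distrib_left cis_mult power2_eq_square cis_cnj flip: mult.assoc) (simp add: algebra_simps)
    qed
    have "((\<chi> i j. A $ i $ j + ?w t * B $ i $ j + (?w t)\<^sup>2 * C $ i $ j) *v u) $ (b, c) = 0" for b c
    proof -
      let ?F = "\<Sum>s\<in>UNIV. h (k + r) b s * F s" and ?G = "\<Sum>s\<in>UNIV. h k c s * G s"
      have "((\<chi> i j. A $ i $ j + ?w t * B $ i $ j + (?w t)\<^sup>2 * C $ i $ j) *v u) $ (b, c)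
        = (\<Sum>s\<in>UNIV. (cnj z + z * (?w t)\<^sup>2) * ((\<delta> (fst s) (flip_parity q l b) * F (fst s)) * (\<delta> (snd s) c * G (snd s)))
            - (1 + (?w t)\<^sup>2) * ((\<delta> (fst s) b * F (fst s)) * (\<delta> (snd s) (flip_parity q l c) * G (snd s)))
            + ?w t * ((h (k + r) b (fst s) * F (fst s)) * (\<delta> (snd s) c * G (snd s)))
            - ?w t * ((\<delta> (fst s) b * F (fst s)) * (h k c (snd s) * G (snd s))))"
        unfolding matrix_vector_mult_def A_def B_def C_def u_def
        by (simp add: algebra_simps)
      also have "\<dots> = (cnj z + z * (?w t)\<^sup>2) * (F (flip_parity q l b) * G c) - (1 + (?w t)\<^sup>2) * (F b * G (flip_parity q l c))
          + ?w t * (?F * G c) - ?w t * (F b * ?G)"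
        unfolding sum.distrib sum_subtractf sum_distrib_left[symmetric]
        by (subst (1 2 3 4) sum_pair) (simp only: sum_\<delta>)
      also have "\<dots> = ?w t * ((?F + e (k $ l + r $ l + t) * F (flip_parity q l b)) * G c)
          - ?w t * (F b * (?G + e (k $ l + t) * G (flip_parity q l c)))"
        unfolding we[symmetric] we'[symmetric] by (simp add: algebra_simps)
      also have "?G + e (k $ l + t) * G (flip_parity q l c) = E * G c"
        using G[of c] by (simp add: bl)
      also have "?F + e (k $ l + r $ l + t) * F (flip_parity q l b) = E * F b"
        using F[of b] bl[of "k + r" F b] by (simp add: add_ac)
      finally show ?thesis by simp
    qed
    then have "(\<chi> i j. A $ i $ j + ?w t * B $ i $ j + (?w t)\<^sup>2 * C $ i $ j) *v u = 0"
      by (simp add: vec_eq_iff)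
    with \<open>u \<noteq> 0\<close> show ?thesis by blast
  qed
  \<comment> \<open>Over one full period distinct \<open>t\<close> give distinct \<open>w\<close>,
    so there are no more bad \<open>t\<close> than singular points of the pencil.\<close>
  have inj: "inj_on ?w {0..<2 * m $ l}"
  proof (rule inj_onI)
    fix s t :: int assume st: "s \<in> {0..<2 * m $ l}" "t \<in> {0..<2 * m $ l}" "?w s = ?w t"
    have "pi * (s - t) / m $ l = pi * (k $ l + s) / m $ l - pi * (k $ l + t) / m $ l"
      by (simp add: diff_divide_distrib[symmetric] algebra_simps)
    then have "cis (pi * (s - t) / m $ l) = ?w s / ?w t" by (simp only: cis_divide)
    also have "\<dots> = 1" using st(3) by simp
    finally have "2 * m $ l dvd s - t" using cis_pi_frac_eq_1_iff[OF ml] by metis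
    then show "s = t" using st(1,2) zdvd_imp_le[of "2 * m $ l" "s - t"] zdvd_imp_le[of "2 * m $ l" "t - s"]
      by (cases s t rule: linorder_cases) (auto simp: dvd_diff_commute)
  qed
  have "card {t \<in> {0..<2 * m $ l}. common_eigenvalue q v m (k + axis l t + r) (k + axis l t)} \<le> card ?W"
    using mem inj by (intro card_inj_on_le[where f = ?w] pencil(1)) (auto intro: inj_on_subset)
  then show ?thesis using pencil(2) by linarith
qed

section \<open>The quantum variance bound\<close>

lemma sum_freqs_shift:
  fixes g :: "int ^ 'd::finite \<Rightarrow> 'b::comm_monoid_add"
  assumes "\<And>l. m $ l > 0"
    and "\<And>k k'. (\<And>l. k $ l mod (2 * m $ l) = k' $ l mod (2 * m $ l)) \<Longrightarrow> g k = g k'"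
  shows "(\<Sum>k\<in>freqs m. g (k + t)) = (\<Sum>k\<in>freqs m. g k)"
  unfolding freqs_def
  by (rule sum_periodic_shift[where p = "\<chi> l. 2 * m $ l", unfolded vec_lambda_beta, OF _ assms(2)])
     (simp_all add: assms(1))

lemma common_eigenvalue_mod:
  assumes "\<And>l. m $ l > 0" "\<And>l. k $ l mod (2 * m $ l) = k1 $ l mod (2 * m $ l)"
    "\<And>l. k' $ l mod (2 * m $ l) = k1' $ l mod (2 * m $ l)"
  shows "common_eigenvalue q v m k k' \<longleftrightarrow> common_eigenvalue q v m k1 k1'"
proof -
  have cos: "cos (pi * k $ l / m $ l) = cos (pi * k' $ l / m $ l)"
    if "k $ l mod (2 * m $ l) = k' $ l mod (2 * m $ l)" for k k' l
    using arg_cong[OF cis_frac_mod[OF assms(1) that, where x = 1], of Re] by simp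
  show ?thesis by (intro common_eigenvalue_cong cos assms)
qed

text \<open>Double counting: shifting along \<open>l\<close> preserves the total, so summing over
  all shifts counts each bad frequency \<open>2 * m $ l\<close> times. Summing over the shift first,
  every line contributes at most the bound for one line.\<close>

lemma card_common_eigenvalue:
  fixes q m r :: "int ^ 'd::finite"
  assumes q: "q $ l \<in> {1, 2}" and m: "\<And>l. m $ l > 0"
    and r: "cis (pi * (r $ l * q $ l) / m $ l) \<noteq> 1"
  shows "2 * m $ l * int (card {k \<in> freqs m. common_eigenvalue q v m (k + r) k})
       \<le> 2 * int CARD('d set \<times> 'd set) * int (card (freqs m))"
proof -
  define g where "g = (\<lambda>k. if common_eigenvalue q v m (k + r) k then 1 else 0 :: int)"
  have per: "g k = g k'" if "\<And>l. k $ l mod (2 * m $ l) = k' $ l mod (2 * m $ l)" for k k'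
    unfolding g_def using that
    by (subst common_eigenvalue_mod[OF m, where ?k1.0 = "k' + r" and ?k1'.0 = k']) (auto intro: mod_add_cong)
  have "2 * m $ l * int (card {k \<in> freqs m. common_eigenvalue q v m (k + r) k})
      = (\<Sum>t\<in>{0..<2 * m $ l}. \<Sum>k\<in>freqs m. g k)"
    using m[of l] by (simp add: g_def sum.If_cases Int_def)
  also have "\<dots> = (\<Sum>t\<in>{0..<2 * m $ l}. \<Sum>k\<in>freqs m. g (k + axis l t))"
    by (simp only: sum_freqs_shift[where g = g, OF m per])
  also have "\<dots> = (\<Sum>k\<in>freqs m. \<Sum>t\<in>{0..<2 * m $ l}. g (k + axis l t))"
    by (rule sum.swap)
  also have "\<dots> \<le> (\<Sum>k\<in>freqs m. 2 * int CARD('d set \<times> 'd set))"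
  proof (rule sum_mono)
    fix k
    have "(\<Sum>t\<in>{0..<2 * m $ l}. g (k + axis l t))
        = int (card {t \<in> {0..<2 * m $ l}. common_eigenvalue q v m (k + axis l t + r) (k + axis l t)})"
      by (simp add: g_def sum.If_cases Int_def)
    also have "\<dots> \<le> int (2 * CARD('d set \<times> 'd set))"
      by (intro of_nat_mono card_common_eigenvalue_line q m r)
    finally show "(\<Sum>t\<in>{0..<2 * m $ l}. g (k + axis l t)) \<le> 2 * int CARD('d set \<times> 'd set)" by simp
  qed
  finally show ?thesis by (simp add: mult.commute)
qed

lemma card_freqs: "card (freqs m) = 2 ^ CARD('d) * (\<Prod>l\<in>UNIV. nat (m $ l))"
  for m :: "int ^ 'd::finite"
  by (simp add: freqs_def card_vec_box nat_mult_distrib prod.distrib)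

text \<open>Pairs are grouped by their difference \<open>r\<close>. Either the Fourier coefficient
  at \<open>r\<close> vanishes by \<open>van\<close>, or some direction makes the frequencies with a
  common eigenvalue rare; Parseval then sums the coefficients.\<close>

lemma sum_common_eigenvalue:
  fixes q m :: "int ^ 'd::finite"
  assumes q: "\<And>l. q $ l \<in> {1, 2}" and M: "0 < M" "\<And>l. M \<le> m $ l"
    and van: "\<And>r. (\<And>l. cis (pi * (r $ l * q $ l) / m $ l) = 1) \<Longrightarrow> (\<Sum>x\<in>sites m. \<alpha> x * wave m r x) = 0"
  shows "(\<Sum>k\<in>freqs m. \<Sum>k'\<in>freqs m. if common_eigenvalue q v m k k'
            then (cmod (\<Sum>x\<in>sites m. \<alpha> x * wave m (k - k') x))\<^sup>2 else 0)
       \<le> CARD('d set \<times> 'd set) / M * (real (card (freqs m)))\<^sup>2 * (\<Sum>x\<in>sites m. (cmod (\<alpha> x))\<^sup>2)"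
proof -
  have m: "m $ l > 0" for l using M(1) M(2)[of l] by linarith
  define a where "a = (\<lambda>r. (cmod (\<Sum>x\<in>sites m. \<alpha> x * wave m r x))\<^sup>2)"
  define b where "b = (\<lambda>k k'. if common_eigenvalue q v m k k' then a (k - k') else 0)"
  \<comment> \<open>The bound on the number of bad frequencies for one difference, obtained from
    \<open>card_common_eigenvalue\<close> after replacing \<open>m $ l\<close> by its lower bound
    \<open>M\<close>.\<close>
  define K where "K = real CARD('d set \<times> 'd set) * card (freqs m) / M"
  have b_per: "b k k' = b k1 k'" if "\<And>l. k $ l mod (2 * m $ l) = k1 $ l mod (2 * m $ l)" for k k1 k'
  proof -
    have "wave m (k - k') x = wave m (k1 - k') x" for x
      using that by (intro wave_mod[OF m]) (auto intro: mod_diff_cong)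
    moreover have "common_eigenvalue q v m k k' \<longleftrightarrow> common_eigenvalue q v m k1 k'"
      using that by (intro common_eigenvalue_mod[OF m]) auto
    ultimately show ?thesis by (simp add: b_def a_def)
  qed
  have "(\<Sum>k\<in>freqs m. \<Sum>k'\<in>freqs m. b k k') = (\<Sum>k'\<in>freqs m. \<Sum>k\<in>freqs m. b k k')"
    by (rule sum.swap)
  also have "\<dots> = (\<Sum>k'\<in>freqs m. \<Sum>r\<in>freqs m. b (r + k') k')"
    by (intro sum.cong refl sum_freqs_shift[OF m, symmetric] b_per)
  also have "\<dots> = (\<Sum>r\<in>freqs m. \<Sum>k\<in>freqs m. b (r + k) k)"
    by (rule sum.swap)
  also have "\<dots> = (\<Sum>r\<in>freqs m. a r * card {k \<in> freqs m. common_eigenvalue q v m (k + r) k})"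
    by (simp add: b_def sum.If_cases Int_def add.commute mult.commute)
  also have "\<dots> \<le> (\<Sum>r\<in>freqs m. a r * K)"
  proof (rule sum_mono)
    fix r
    let ?c = "card {k \<in> freqs m. common_eigenvalue q v m (k + r) k}"
    show "a r * ?c \<le> a r * K"
    proof (cases "\<forall>l. cis (pi * (r $ l * q $ l) / m $ l) = 1")
      case True
      then show ?thesis using van[of r] by (simp add: a_def)
    next
      case False
      then obtain l where l: "cis (pi * (r $ l * q $ l) / m $ l) \<noteq> 1" by blast
      have "M * int ?c \<le> m $ l * int ?c" using M(2) by (simp add: mult_right_mono)
      also have "\<dots> \<le> int CARD('d set \<times> 'd set) * int (card (freqs m))"
        using card_common_eigenvalue[OF q m l, of v] by simp
      finally have "of_int (M * int ?c) \<le> (of_int (int CARD('d set \<times> 'd set) * int (card (freqs m))) :: real)"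
        by (simp only: of_int_le_iff)
      then have "?c \<le> K" using M(1) by (simp add: K_def field_simps)
      then show ?thesis by (intro mult_left_mono) (simp_all add: a_def)
    qed
  qed
  also have "\<dots> = (card (freqs m) * (\<Sum>x\<in>sites m. (cmod (\<alpha> x))\<^sup>2)) * K"
    by (simp only: parseval_wave a_def flip: sum_distrib_right)
  finally show ?thesis unfolding b_def a_def K_def by (simp add: power2_eq_square mult_ac)
qed

section \<open>From counting pairs to the variance\<close>

lemma wave_diff: "wave m (k - k') x = wave m k x * cnj (wave m k' x)"
  unfolding cnj_wave wave_add_left[symmetric] by simp

lemma sum_rotate:
  "(\<Sum>a\<in>A. \<Sum>b\<in>B. \<Sum>c\<in>C. F a b c) = (\<Sum>b\<in>B. \<Sum>c\<in>C. \<Sum>a\<in>A. F a b c)"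
proof -
  have "(\<Sum>a\<in>A. \<Sum>b\<in>B. \<Sum>c\<in>C. F a b c) = (\<Sum>b\<in>B. \<Sum>a\<in>A. \<Sum>c\<in>C. F a b c)"
    by (rule sum.swap)
  also have "\<dots> = (\<Sum>b\<in>B. \<Sum>c\<in>C. \<Sum>a\<in>A. F a b c)"
    by (rule sum.cong[OF refl], rule sum.swap)
  finally show ?thesis .
qed

text \<open>The scaled variance \<open>n\<^sup>2 * S\<close> is the pairing of \<open>G\<close> with
  the Fourier coefficients \<open>a (k - k')\<close>, and it is also the squared norm of
  \<open>G\<close>. As \<open>G\<close> lives on pairs with a common eigenvalue, Cauchy-Schwarz
  followed by cancelling one factor bounds it by the Fourier mass on those pairs.\<close>

lemma quantum_variance_le:
  fixes q m :: "int ^ 'd::finite" and \<psi> :: "'j \<Rightarrow> int ^ 'd \<Rightarrow> complex"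
  assumes q: "\<And>l. q $ l \<in> {1, 2}" and M: "0 < M" "\<And>l. M \<le> m $ l"
    and J: "finite J"
    and on: "\<And>i j. i \<in> J \<Longrightarrow> j \<in> J \<Longrightarrow> l2_inner (sites m) (\<psi> i) (\<psi> j) = (if i = j then 1 else 0)"
    and eig: "\<And>j. j \<in> J \<Longrightarrow> \<exists>E. dirichlet_op (sites m) V (\<psi> j) = (\<lambda>x. E * \<psi> j x)"
    and V: "\<And>x. complex_of_real (V x) = v (parity_class q x)"
    and van: "\<And>r. (\<And>l. cis (pi * (r $ l * q $ l) / m $ l) = 1) \<Longrightarrow> (\<Sum>x\<in>sites m. \<alpha> x * wave m r x) = 0"
  shows "(\<Sum>j\<in>J. (cmod (\<Sum>x\<in>sites m. \<alpha> x * (\<psi> j x * cnj (\<psi> j x))))\<^sup>2)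
       \<le> 4 ^ CARD('d) * CARD('d set \<times> 'd set) / M * (\<Sum>x\<in>sites m. (cmod (\<alpha> x))\<^sup>2)"
proof -
  have m: "m $ l > 0" for l using M(1) M(2)[of l] by linarith
  define n where "n = (\<Prod>l\<in>UNIV. real_of_int (m $ l))"
  have n: "n > 0" unfolding n_def by (rule prod_pos) (simp add: m)
  define f where "f = (\<lambda>j k. \<Sum>x\<in>sites m. \<psi> j x * sine m k x)"
  define w where "w = (\<lambda>j. \<Sum>x\<in>sites m. \<alpha> x * (\<psi> j x * cnj (\<psi> j x)))"
  define S where "S = (\<Sum>j\<in>J. (cmod (w j))\<^sup>2)"
  define a where "a = (\<lambda>r. \<Sum>x\<in>sites m. \<alpha> x * wave m r x)"
  \<comment> \<open>The weights \<open>cnj (w j)\<close> are chosen so that pairing \<open>G\<close>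
    with \<open>a (k - k')\<close> reproduces the sum of the squares of
    \<open>cmod (w j)\<close>.\<close>
  define G where "G = (\<lambda>k k'. \<Sum>j\<in>J. cnj (w j) * (f j k * cnj (f j k')))"
  define b where "b = (\<lambda>k k'. if common_eigenvalue q v m k k' then a (k - k') else 0)"
  let ?c = "\<Prod>l\<in>(UNIV :: 'd set). \<i> * of_int (m $ l)"
  have "?c * cnj ?c = (\<Prod>l\<in>UNIV. of_int (m $ l) * of_int (m $ l))"
    unfolding cnj_prod prod.distrib[symmetric] by (rule prod.cong) (simp_all add: complex_eq_iff)
  then have c: "?c * cnj ?c = complex_of_real (n\<^sup>2)"
    by (simp add: n_def prod.distrib power2_eq_square)
  have recon: "(\<Sum>k\<in>freqs m. f j k * wave m k y) = ?c * \<psi> j y" if "y \<in> sites m" for j y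
  proof -
    have "(\<Sum>k\<in>freqs m. f j k * wave m k y)
        = (\<Sum>k\<in>freqs m. \<Sum>x\<in>sites m. \<psi> j x * (sine m k x * wave m k y))"
      unfolding f_def sum_distrib_right by (simp only: mult.assoc)
    also have "\<dots> = (\<Sum>x\<in>sites m. \<psi> j x * (\<Sum>k\<in>freqs m. sine m k x * wave m k y))"
      unfolding sum_distrib_left by (rule sum.swap)
    also have "\<dots> = (\<Sum>x\<in>sites m. if x = y then ?c * \<psi> j y else 0)"
      by (rule sum.cong) (auto simp: sum_sine_wave that)
    finally show ?thesis using that by simp
  qed
  have w_f: "complex_of_real (n\<^sup>2) * w j = (\<Sum>k\<in>freqs m. \<Sum>k'\<in>freqs m. f j k * cnj (f j k') * a (k - k'))" for j
  proof -
    have "complex_of_real (n\<^sup>2) * w j = (\<Sum>x\<in>sites m. \<alpha> x * ((?c * \<psi> j x) * cnj (?c * \<psi> j x)))"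
      unfolding w_def sum_distrib_left
      unfolding c[symmetric] by (rule sum.cong) (simp_all only: complex_cnj_mult mult_ac)
    also have "\<dots> = (\<Sum>x\<in>sites m. \<alpha> x * ((\<Sum>k\<in>freqs m. f j k * wave m k x) * cnj (\<Sum>k\<in>freqs m. f j k * wave m k x)))"
      by (intro sum.cong refl) (simp only: recon)
    also have "\<dots> = (\<Sum>x\<in>sites m. \<alpha> x * (\<Sum>k\<in>freqs m. \<Sum>k'\<in>freqs m. (f j k * wave m k x) * cnj (f j k' * wave m k' x)))"
      unfolding cnj_sum sum_product ..
    also have "\<dots> = (\<Sum>x\<in>sites m. \<Sum>k\<in>freqs m. \<Sum>k'\<in>freqs m. f j k * cnj (f j k') * (\<alpha> x * wave m (k - k') x))"
      unfolding sum_distrib_left wave_diff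
      by (intro sum.cong refl) (simp add: mult_ac)
    also have "\<dots> = (\<Sum>k\<in>freqs m. \<Sum>k'\<in>freqs m. f j k * cnj (f j k') * a (k - k'))"
      unfolding a_def sum_distrib_left by (rule sum_rotate)
    finally show ?thesis .
  qed
  \<comment> \<open>Up to the factor \<open>n\<close>, passing to sine coefficients is an isometry,
    so the coefficient vectors of the \<open>\<psi> j\<close> stay orthogonal.\<close>
  have parseval: "(\<Sum>k\<in>freqs m. f i k * cnj (f j k)) = (if i = j then n else 0)" if "i \<in> J" "j \<in> J" for i j
  proof -
    have cnj_sine: "cnj (sine m k x) = sine m k x" for k x
      by (simp add: sine_def)
    have "(\<Sum>k\<in>freqs m. f i k * cnj (f j k))
        = (\<Sum>k\<in>freqs m. \<Sum>x\<in>sites m. \<Sum>y\<in>sites m. \<psi> i x * cnj (\<psi> j y) * (sine m k x * sine m k y))"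
      unfolding f_def cnj_sum sum_product by (intro sum.cong refl) (simp add: cnj_sine mult_ac)
    also have "\<dots> = (\<Sum>x\<in>sites m. \<Sum>y\<in>sites m. \<psi> i x * cnj (\<psi> j y) * (\<Sum>k\<in>freqs m. sine m k x * sine m k y))"
      unfolding sum_distrib_left by (rule sum_rotate)
    also have "\<dots> = (\<Sum>x\<in>sites m. \<Sum>y\<in>sites m. if x = y then \<psi> i x * cnj (\<psi> j x) * n else 0)"
      by (intro sum.cong refl) (simp add: sum_sine_sine n_def)
    also have "\<dots> = n * l2_inner (sites m) (\<psi> j) (\<psi> i)"
      by (simp add: l2_inner_def sum_distrib_left mult_ac)
    finally show ?thesis using on[OF that(2,1)] by auto
  qed
  \<comment> \<open>\<open>G\<close> is a combination of rank-one kernels that are mutually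
    orthogonal by \<open>parseval\<close>, each of squared norm \<open>n\<^sup>2\<close>.\<close>
  have normG: "(\<Sum>k\<in>freqs m. \<Sum>k'\<in>freqs m. (cmod (G k k'))\<^sup>2) = n\<^sup>2 * S"
  proof -
    have "complex_of_real (\<Sum>k\<in>freqs m. \<Sum>k'\<in>freqs m. (cmod (G k k'))\<^sup>2)
        = (\<Sum>k\<in>freqs m. \<Sum>k'\<in>freqs m. \<Sum>i\<in>J. \<Sum>j\<in>J.
            cnj (w i) * w j * ((f i k * cnj (f j k)) * cnj (f i k' * cnj (f j k'))))"
      unfolding of_real_sum complex_norm_square G_def cnj_sum sum_product
      by (intro sum.cong refl) (simp add: mult_ac)
    also have "\<dots> = (\<Sum>k\<in>freqs m. \<Sum>i\<in>J. \<Sum>j\<in>J. \<Sum>k'\<in>freqs m.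
            cnj (w i) * w j * ((f i k * cnj (f j k)) * cnj (f i k' * cnj (f j k'))))"
      by (intro sum.cong[OF refl] sum_rotate)
    also have "\<dots> = (\<Sum>i\<in>J. \<Sum>j\<in>J. \<Sum>k\<in>freqs m. \<Sum>k'\<in>freqs m.
            cnj (w i) * w j * ((f i k * cnj (f j k)) * cnj (f i k' * cnj (f j k'))))"
      by (rule sum_rotate)
    also have "\<dots> = (\<Sum>i\<in>J. \<Sum>j\<in>J. cnj (w i) * w j *
            ((\<Sum>k\<in>freqs m. f i k * cnj (f j k)) * cnj (\<Sum>k\<in>freqs m. f i k * cnj (f j k))))"
      unfolding cnj_sum sum_product unfolding sum_distrib_left ..
    also have "\<dots> = (\<Sum>i\<in>J. \<Sum>j\<in>J. if i = j then complex_of_real (n\<^sup>2) * (w i * cnj (w i)) else 0)"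
      by (intro sum.cong refl) (auto simp: parseval power2_eq_square)
    also have "\<dots> = complex_of_real (n\<^sup>2 * S)"
      unfolding S_def of_real_mult of_real_sum complex_norm_square using J
      by (simp add: sum_distrib_left)
    finally show ?thesis by (simp only: of_real_eq_iff)
  qed
  have Gb: "G k k' * a (k - k') = G k k' * b k k'" for k k'
  proof (cases "common_eigenvalue q v m k k'")
    case True
    then show ?thesis by (simp add: b_def)
  next
    case False
    have "f j k * cnj (f j k') = 0" if "j \<in> J" for j
    proof (rule ccontr)
      assume "f j k * cnj (f j k') \<noteq> 0"
      then have "f j k \<noteq> 0" "f j k' \<noteq> 0" by auto
      moreover obtain E where "dirichlet_op (sites m) V (\<psi> j) = (\<lambda>x. E * \<psi> j x)"
        using eig[OF \<open>j \<in> J\<close>] by blast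
      ultimately show False using False common_eigenvalueI[of m V "\<psi> j" E v q k k'] V
        by (simp add: f_def)
    qed
    then have "G k k' = 0" unfolding G_def by (intro sum.neutral) auto
    then show ?thesis by simp
  qed
  have "complex_of_real (n\<^sup>2 * S) = (\<Sum>j\<in>J. cnj (w j) * (complex_of_real (n\<^sup>2) * w j))"
    unfolding S_def of_real_mult of_real_sum complex_norm_square by (simp add: sum_distrib_left mult_ac)
  also have "\<dots> = (\<Sum>j\<in>J. \<Sum>k\<in>freqs m. \<Sum>k'\<in>freqs m. cnj (w j) * (f j k * cnj (f j k')) * a (k - k'))"
    by (simp only: w_f sum_distrib_left mult.assoc)
  also have "\<dots> = (\<Sum>k\<in>freqs m. \<Sum>k'\<in>freqs m. G k k' * a (k - k'))"
    unfolding G_def sum_distrib_right by (rule sum_rotate)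
  also have "\<dots> = (\<Sum>p\<in>freqs m \<times> freqs m. G (fst p) (snd p) * b (fst p) (snd p))"
    by (simp only: Gb sum.cartesian_product split_def)
  finally have "n\<^sup>2 * S = cmod (\<Sum>p\<in>freqs m \<times> freqs m. G (fst p) (snd p) * b (fst p) (snd p))"
    using sum_nonneg[of J "\<lambda>j. (cmod (w j))\<^sup>2"] by (metis S_def norm_of_real abs_of_nonneg mult_nonneg_nonneg zero_le_power2)
  also have "\<dots> \<le> (\<Sum>p\<in>freqs m \<times> freqs m. cmod (G (fst p) (snd p)) * cmod (b (fst p) (snd p)))"
    by (rule order.trans[OF norm_sum]) (simp add: norm_mult)
  finally have le: "n\<^sup>2 * S \<le> (\<Sum>p\<in>freqs m \<times> freqs m. cmod (G (fst p) (snd p)) * cmod (b (fst p) (snd p)))" .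
  let ?T = "\<Sum>p\<in>freqs m \<times> freqs m. (cmod (b (fst p) (snd p)))\<^sup>2"
  have S0: "S \<ge> 0" by (simp add: S_def sum_nonneg)
  have "(n\<^sup>2 * S)\<^sup>2 \<le> (\<Sum>p\<in>freqs m \<times> freqs m. cmod (G (fst p) (snd p)) * cmod (b (fst p) (snd p)))\<^sup>2"
    using le S0 by (intro power_mono) auto
  also have "\<dots> \<le> (\<Sum>p\<in>freqs m \<times> freqs m. (cmod (G (fst p) (snd p)))\<^sup>2) * ?T"
    by (rule Cauchy_Schwarz_ineq_sum)
  also have "(\<Sum>p\<in>freqs m \<times> freqs m. (cmod (G (fst p) (snd p)))\<^sup>2) = n\<^sup>2 * S"
    unfolding normG[symmetric] by (simp only: sum.cartesian_product split_def)
  finally have "(n\<^sup>2 * S) * (n\<^sup>2 * S) \<le> (n\<^sup>2 * S) * ?T" by (simp add: power2_eq_square)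
  \<comment> \<open>The common factor can be cancelled only if \<open>S\<close> is nonzero; for
    \<open>S = 0\<close> the bound is trivial.\<close>
  then have "n\<^sup>2 * S \<le> ?T"
    using S0 n by (cases "S = 0") (auto simp: sum_nonneg)
  also have "?T = (\<Sum>k\<in>freqs m. \<Sum>k'\<in>freqs m. if common_eigenvalue q v m k k' then (cmod (a (k - k')))\<^sup>2 else 0)"
    by (simp add: sum.cartesian_product split_def b_def if_distrib[of "\<lambda>x. (cmod x)\<^sup>2"] cong: if_cong)
  also have "\<dots> \<le> CARD('d set \<times> 'd set) / M * (real (card (freqs m)))\<^sup>2 * (\<Sum>x\<in>sites m. (cmod (\<alpha> x))\<^sup>2)"
    unfolding a_def by (rule sum_common_eigenvalue[OF q M van])
  \<comment> \<open>The doubled frequency period costs a factor 2 per direction; squared, this is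
    the constant \<open>4 ^ CARD('d)\<close>.\<close>
  also have "real (card (freqs m)) = 2 ^ CARD('d) * n"
    using m by (simp add: card_freqs n_def less_imp_le)
  also have "CARD('d set \<times> 'd set) / M * (2 ^ CARD('d) * n)\<^sup>2 * (\<Sum>x\<in>sites m. (cmod (\<alpha> x))\<^sup>2)
      = n\<^sup>2 * (4 ^ CARD('d) * CARD('d set \<times> 'd set) / M * (\<Sum>x\<in>sites m. (cmod (\<alpha> x))\<^sup>2))"
    by (simp add: power_mult_distrib power_even_eq[symmetric] flip: power_mult)
       (simp add: power_mult mult.commute[of _ 2])
  finally have "S \<le> 4 ^ CARD('d) * CARD('d set \<times> 'd set) / M * (\<Sum>x\<in>sites m. (cmod (\<alpha> x))\<^sup>2)"
    using n by (simp only: mult_le_cancel_left_pos zero_less_power)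
  then show ?thesis by (simp add: S_def w_def)
qed

section \<open>Periodic blocks\<close>

text \<open>The far Dirichlet wall is one step beyond the last site, which explains the
  \<open>+ 1\<close>.\<close>

lemma block_eq_sites: "block q N = sites (\<chi> l. q $ l * int N + 1)"
  by (auto simp: block_def sites_def vec_box_def)

text \<open>Division with remainder in each coordinate. Coordinates start at 1, so the quotient is
  taken of \<open>x - 1\<close>.\<close>

lemma sum_block:
  fixes q :: "int ^ 'd::finite" and g :: "int ^ 'd \<Rightarrow> 'b::comm_monoid_add"
  assumes q: "\<And>l. q $ l > 0"
  shows "(\<Sum>x\<in>block q N. g x) = (\<Sum>y\<in>block q 1. \<Sum>k\<in>block_shifts q N. g (y + k))"
proof -
  have 1: "(x - 1) div c * c \<le> x - 1" "x - 1 < ((x - 1) div c + 1) * c" if "c > 0" for x c :: int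
  proof -
    have "x - 1 = (x - 1) div c * c + (x - 1) mod c" by simp
    moreover have "0 \<le> (x - 1) mod c" "(x - 1) mod c < c" using that by simp_all
    ultimately show "(x - 1) div c * c \<le> x - 1" "x - 1 < ((x - 1) div c + 1) * c"
      unfolding distrib_right by linarith+
  qed
  have bound: "x + n * c \<le> c * int N" "1 \<le> x + n * c" "(x + n * c - 1) div c = n"
    if "c > 0" "1 \<le> x" "x \<le> c" "0 \<le> n" "n \<le> int N - 1" for x n c :: int
  proof -
    have "n * c \<le> (int N - 1) * c" using that by (intro mult_right_mono) auto
    then show "x + n * c \<le> c * int N" using that by (simp add: algebra_simps)
    have "0 \<le> n * c" using that by simp
    then show "1 \<le> x + n * c" using that(2) by linarith
    have "(x + n * c - 1) div c = (x - 1 + n * c) div c" by (simp add: algebra_simps)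
    also have "\<dots> = n" using that by (simp add: div_pos_pos_trivial)
    finally show "(x + n * c - 1) div c = n" .
  qed
  let ?n = "\<lambda>x. \<chi> l. (x $ l - 1) div q $ l"
  have "(\<Sum>x\<in>block q N. g x) = (\<Sum>p\<in>block q 1 \<times> block_shifts q N. g (fst p + snd p))"
  proof (rule sum.reindex_bij_witness[where
        i = "\<lambda>p. fst p + snd p" and j = "\<lambda>x. (x - lattice_vec q (?n x), lattice_vec q (?n x))"])
    fix x assume x: "x \<in> block q N"
    have "1 \<le> x $ l - (x $ l - 1) div q $ l * q $ l \<and> x $ l - (x $ l - 1) div q $ l * q $ l \<le> q $ l" for l
      using 1[OF q[of l], of "x $ l"] unfolding distrib_right by linarith
    then have "x - lattice_vec q (?n x) \<in> block q 1"
      by (simp add: block_def lattice_vec_def)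
    moreover have "(x $ l - 1) div q $ l \<in> {0..int N - 1}" for l
    proof -
      have "1 \<le> x $ l" "x $ l \<le> q $ l * int N" using x by (auto simp: block_def)
      moreover from this have "(x $ l - 1) div q $ l * q $ l < int N * q $ l"
        using 1(1)[OF q[of l], of "x $ l"] by (simp add: mult.commute)
      then have "(x $ l - 1) div q $ l < int N"
        using q[of l] by (simp add: mult_less_cancel_right)
      ultimately show ?thesis using q[of l] by (simp add: pos_imp_zdiv_nonneg_iff)
    qed
    then have "lattice_vec q (?n x) \<in> block_shifts q N"
      unfolding block_shifts_def by (intro CollectI exI[of _ "?n x"]) simp
    ultimately show "(x - lattice_vec q (?n x), lattice_vec q (?n x)) \<in> block q 1 \<times> block_shifts q N"
      by simp
  next
    fix p assume p: "p \<in> block q 1 \<times> block_shifts q N"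
    obtain n where n: "snd p = lattice_vec q n" "\<And>l. n $ l \<in> {0..int N - 1}"
      using p by (auto simp: block_shifts_def)
    have y: "1 \<le> fst p $ l" "fst p $ l \<le> q $ l" for l using p by (auto simp: block_def)
    have "?n (fst p + snd p) = n"
      using bound(3)[OF q y] n(2) by (simp add: vec_eq_iff n(1) lattice_vec_def)
    then show "(fst p + snd p - lattice_vec q (?n (fst p + snd p)), lattice_vec q (?n (fst p + snd p))) = p"
      by (simp add: n(1)[symmetric])
    show "fst p + snd p \<in> block q N"
      using bound(1,2)[OF q y] n(2) by (simp add: block_def n(1) lattice_vec_def)
  qed auto
  then show ?thesis by (simp add: sum.cartesian_product split_def)
qed

lemma wave_lattice_shift:
  assumes "\<And>l. cis (pi * (r $ l * q $ l) / m $ l) = 1" "k \<in> block_shifts q N"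
  shows "wave m r k = 1"
proof -
  obtain n where n: "k = lattice_vec q n" "\<And>l. n $ l \<in> {0..int N - 1}"
    using assms(2) by (auto simp: block_shifts_def)
  have "cis (pi * (r $ l * k $ l) / m $ l) = cis (pi * (r $ l * q $ l) / m $ l) ^ nat (n $ l)" for l
    using n(2)[of l] by (simp add: n(1) lattice_vec_def Complex.DeMoivre mult_ac)
  then show ?thesis by (simp only: wave_def assms(1) power_one prod.neutral_const)
qed

text \<open>For such \<open>r\<close> the wave is periodic under the lattice and factors out of each
  sum over translates. By the block condition these sums agree for all base sites, and subtracting
  the mean makes each of them 0.\<close>

lemma sum_wave_eq_0:
  fixes q :: "int ^ 'd::finite" and a :: "int ^ 'd \<Rightarrow> complex"
  assumes q: "\<And>l. q $ l > 0"
    and block: "\<And>x y. x \<in> block q 1 \<Longrightarrow> y \<in> block q 1 \<Longrightarrow>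
           (\<Sum>k\<in>block_shifts q N. a (x + k)) = (\<Sum>k\<in>block_shifts q N. a (y + k))"
    and r: "\<And>l. cis (pi * (r $ l * q $ l) / m $ l) = 1"
  shows "(\<Sum>x\<in>block q N. (a x - (\<Sum>x\<in>block q N. a x) / of_nat (card (block q N))) * wave m r x) = 0"
proof -
  let ?s = "\<Sum>k\<in>block_shifts q N. a (1 + k)" and ?c = "(\<Sum>x\<in>block q N. a x) / of_nat (card (block q N))"
  have one: "1 \<in> block q 1"
    using q by (auto simp: block_def) (metis int_one_le_iff_zero_less)
  have a: "(\<Sum>k\<in>block_shifts q N. a (y + k)) = ?s" if "y \<in> block q 1" for y
    using block[OF that one] .
  have fin: "finite (block q 1)" by (simp add: block_eq_sites)
  have "card (block q N) = card (block q 1) * card (block_shifts q N)"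
    using sum_block[OF q, of "\<lambda>_. 1 :: nat" N] by simp
  moreover have "(\<Sum>x\<in>block q N. a x) = of_nat (card (block q 1)) * ?s"
    by (simp add: sum_block[OF q, of a] a)
  moreover have "card (block q 1) \<noteq> 0" using one fin by auto
  \<comment> \<open>If the set of shifts has cardinality 0, then \<open>?s\<close> is 0 and both
    sides vanish.\<close>
  ultimately have c: "of_nat (card (block_shifts q N)) * ?c = ?s"
    by (cases "card (block_shifts q N) = 0") (auto simp: card_eq_0_iff field_simps)
  have "(\<Sum>x\<in>block q N. (a x - ?c) * wave m r x)
      = (\<Sum>y\<in>block q 1. (\<Sum>k\<in>block_shifts q N. a (y + k) - ?c) * wave m r y)"
    unfolding sum_block[OF q, of "\<lambda>x. (a x - ?c) * wave m r x"] sum_distrib_right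
    by (intro sum.cong refl) (simp add: wave_add_right wave_lattice_shift[OF r])
  also have "\<dots> = (\<Sum>y\<in>block q 1. (?s - ?s) * wave m r y)"
    by (intro sum.cong refl) (simp only: sum_subtractf a sum_constant c)
  finally show ?thesis by simp
qed

text \<open>The indicator vector of the parity class is a representative of \<open>x\<close> modulo
  the lattice: the difference is divisible by \<open>q $ l\<close> in every direction.\<close>

lemma periodic_potential_parity_class:
  fixes q :: "int ^ 'd::finite"
  assumes "\<forall>l. q $ l \<in> {1, 2}" "periodic_potential q V"
  shows "V x = V (\<chi> l. if l \<in> parity_class q x then 1 else 0)"
proof -
  define y :: "int ^ 'd" where "y = (\<chi> l. if l \<in> parity_class q x then 1 else 0)"
  have "(x $ l - y $ l) div q $ l * q $ l = x $ l - y $ l" for l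
    using spec[OF assms(1), of l] by (auto simp: y_def parity_class_def)
  then have "x - y = lattice_vec q (\<chi> l. (x $ l - y $ l) div q $ l)"
    by (simp add: lattice_vec_def vec_eq_iff)
  then have "x - y \<in> period_lattice q" by (auto simp: period_lattice_def)
  then have "V (y + (x - y)) = V y"
    using assms(2) unfolding periodic_potential_def by blast
  then show ?thesis by (simp add: y_def)
qed

section \<open>The variance is at most a constant over \<open>N\<close>, hence tends to 0\<close>

theorem theorem1p5:
  fixes q :: "int ^ 'd::finite"
    and V :: "int ^ 'd \<Rightarrow> real"
    and \<psi> :: "nat \<Rightarrow> nat \<Rightarrow> int ^ 'd \<Rightarrow> complex"
    and a :: "nat \<Rightarrow> int ^ 'd \<Rightarrow> int ^ 'd \<Rightarrow> complex"
  assumes "\<forall>l. q $ l \<in> {1, 2}"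
    and "periodic_potential q V"
    and "\<forall>N\<ge>1. orthonormal_basis_on (block q N) {1..card (block q N)} (\<psi> N)"
    and "\<forall>N\<ge>1. \<forall>j\<in>{1..card (block q N)}.
           eigenfunction_on (block q N) (dirichlet_op (block q N) V) (\<psi> N j)"
    and "\<forall>N\<ge>1. diagonal_on (block q N) (a N)"
    and "\<forall>N\<ge>1. diag_sup_norm (block q N) (a N) \<le> 1"
    and "\<forall>N\<ge>1. \<forall>x\<in>block q 1. \<forall>y\<in>block q 1.
           (\<Sum>k\<in>block_shifts q N. a N (x + k) (x + k)) =
           (\<Sum>k\<in>block_shifts q N. a N (y + k) (y + k))"
  shows "(\<lambda>N. 1 / real (card (block q N)) *
            (\<Sum>j = 1..card (block q N).
               (cmod (l2_inner (block q N) (\<psi> N j) (kernel_op (block q N) (a N) (\<psi> N j))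
                      - diag_average (block q N) (a N)))\<^sup>2)) \<longlonglongrightarrow> 0"
proof -
  \<comment> \<open>The constant of \<open>quantum_variance_le\<close> times 4, the bound on the
    squared modulus of the centred observable.\<close>
  define K where "K = 4 ^ CARD('d) * real CARD('d set \<times> 'd set) * 4"
  let ?v = "\<lambda>N. 1 / real (card (block q N)) *
            (\<Sum>j = 1..card (block q N).
               (cmod (l2_inner (block q N) (\<psi> N j) (kernel_op (block q N) (a N) (\<psi> N j))
                      - diag_average (block q N) (a N)))\<^sup>2)"
  have q: "q $ l \<in> {1, 2}" "q $ l > 0" for l using spec[OF assms(1), of l] by auto
  have v_le: "?v N \<le> K / real N" if N: "N \<ge> 1" for N
  proof -
    define m :: "int ^ 'd" where "m = (\<chi> l. q $ l * int N + 1)"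
    define A where "A = block q N"
    define J where "J = {1..card A}"
    define \<alpha> where "\<alpha> = (\<lambda>x. a N x x - diag_average A (a N))"
    have A: "A = sites m" by (simp add: A_def m_def block_eq_sites)
    have finA: "finite A" by (simp add: A)
    have "1 \<in> A"
    proof -
      have "1 \<le> q $ l * int N" for l using q(2)[of l] N by (simp add: int_one_le_iff_zero_less)
      then show ?thesis by (simp add: A_def block_def)
    qed
    then have cardA: "card A > 0" using finA by (auto simp: card_gt_0_iff)
    have orth: "l2_inner A (\<psi> N i) (\<psi> N j) = (if i = j then 1 else 0)" if "i \<in> J" "j \<in> J" for i j
      using assms(3) N that by (simp add: orthonormal_basis_on_def A_def J_def)
    \<comment> \<open>Normalisation of \<open>\<psi> N j\<close> lets the average be absorbed into
      the observable, which turns it into the centred \<open>\<alpha>\<close>.\<close>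
    have inner: "l2_inner A (\<psi> N j) (kernel_op A (a N) (\<psi> N j)) - diag_average A (a N)
        = (\<Sum>x\<in>A. \<alpha> x * (\<psi> N j x * cnj (\<psi> N j x)))" if "j \<in> J" for j
    proof -
      have "kernel_op A (a N) (\<psi> N j) x = a N x x * \<psi> N j x" if x: "x \<in> A" for x
      proof -
        have "(\<Sum>y\<in>A. a N x y * \<psi> N j y) = (\<Sum>y\<in>A. if y = x then a N x x * \<psi> N j x else 0)"
          using assms(5) N x by (intro sum.cong) (auto simp: diagonal_on_def A_def)
        then show ?thesis using x finA by (simp add: kernel_op_def)
      qed
      then have "l2_inner A (\<psi> N j) (kernel_op A (a N) (\<psi> N j)) - diag_average A (a N)
         = (\<Sum>x\<in>A. a N x x * (\<psi> N j x * cnj (\<psi> N j x))) - diag_average A (a N) * l2_inner A (\<psi> N j) (\<psi> N j)"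
        using orth[OF that that] by (simp add: l2_inner_def mult_ac)
      then show ?thesis
        unfolding l2_inner_def \<alpha>_def sum_distrib_left sum_subtractf[symmetric]
        by (simp add: algebra_simps)
    qed
    have a1: "cmod (a N x x) \<le> 1" if "x \<in> A" for x
      using cSUP_upper[OF that, of "\<lambda>x. cmod (a N x x)"] finA assms(6) N
      by (fastforce simp: diag_sup_norm_def A_def)
    have "cmod (\<Sum>x\<in>A. a N x x) \<le> real (card A)"
      using sum_norm_bound[of A "\<lambda>x. a N x x" 1] a1 by simp
    then have avg: "cmod (diag_average A (a N)) \<le> 1"
      using cardA by (simp add: diag_average_def norm_divide divide_le_eq)
    \<comment> \<open>Both the observable and its average have modulus at most 1, so their
      difference has modulus at most 2.\<close>
    have "(cmod (\<alpha> x))\<^sup>2 \<le> 4" if "x \<in> A" for x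
      using power_mono[of "cmod (\<alpha> x)" 2 2] norm_triangle_ineq4[of "a N x x" "diag_average A (a N)"] a1[OF that] avg
      by (simp add: \<alpha>_def)
    then have \<alpha>4: "(\<Sum>x\<in>A. (cmod (\<alpha> x))\<^sup>2) \<le> 4 * card A"
      using sum_bounded_above[of A "\<lambda>x. (cmod (\<alpha> x))\<^sup>2" 4] by simp
    have "(\<Sum>j\<in>J. (cmod (\<Sum>x\<in>sites m. \<alpha> x * (\<psi> N j x * cnj (\<psi> N j x))))\<^sup>2)
       \<le> 4 ^ CARD('d) * CARD('d set \<times> 'd set) / real_of_int (int N) * (\<Sum>x\<in>sites m. (cmod (\<alpha> x))\<^sup>2)"
    \<comment> \<open>Here \<open>M\<close> is \<open>N\<close>, since
      \<open>m $ l = q $ l * N + 1\<close>, and the potential on a class is read off at its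
      indicator vector.\<close>
    proof (rule quantum_variance_le)
      show "q $ l \<in> {1, 2}" for l by (rule q)
      show "0 < int N" using N by simp
      show "int N \<le> m $ l" for l
        using mult_right_mono[of 1 "q $ l" "int N"] q(2)[of l] by (simp add: m_def)
      show "finite J" by (simp add: J_def)
      show "l2_inner (sites m) (\<psi> N i) (\<psi> N j) = (if i = j then 1 else 0)" if "i \<in> J" "j \<in> J" for i j
        using orth[OF that] by (simp add: A)
      show "\<exists>E. dirichlet_op (sites m) V (\<psi> N j) = (\<lambda>x. E * \<psi> N j x)" if "j \<in> J" for j
        using assms(4) N that by (auto simp: eigenfunction_on_def J_def A_def[symmetric] A[symmetric])
      show "complex_of_real (V x) = complex_of_real (V (\<chi> l. if l \<in> parity_class q x then 1 else 0))" for x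
        using periodic_potential_parity_class[OF assms(1,2)] by metis
      show "(\<Sum>x\<in>sites m. \<alpha> x * wave m r x) = 0"
        if "\<And>l. cis (pi * (r $ l * q $ l) / m $ l) = 1" for r
      proof -
        have "(\<Sum>x\<in>block q N. (a N x x - (\<Sum>x\<in>block q N. a N x x) / of_nat (card (block q N))) * wave m r x) = 0"
          by (rule sum_wave_eq_0[where q = q, OF q(2) _ that]) (use assms(7) N in blast)
        then show ?thesis by (simp only: \<alpha>_def diag_average_def A[symmetric] A_def)
      qed
    qed
    also have "\<dots> \<le> 4 ^ CARD('d) * CARD('d set \<times> 'd set) / real_of_int (int N) * (4 * card A)"
      using \<alpha>4 by (intro mult_left_mono) (simp_all add: A)
    also have "\<dots> = K / real N * card A" by (simp add: K_def)
    finally have "(\<Sum>j\<in>J. (cmod (\<Sum>x\<in>A. \<alpha> x * (\<psi> N j x * cnj (\<psi> N j x))))\<^sup>2) / card A \<le> K / real N"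
      using cardA by (simp add: A divide_le_eq)
    then show "?v N \<le> K / real N"
      unfolding A_def[symmetric] J_def[symmetric] by (simp add: inner)
  qed
  show ?thesis
  proof (rule tendsto_sandwich[OF _ _ tendsto_const])
    show "\<forall>\<^sub>F N in sequentially. 0 \<le> ?v N"
      by (intro always_eventually allI mult_nonneg_nonneg sum_nonneg) auto
    show "\<forall>\<^sub>F N in sequentially. ?v N \<le> K / real N"
      using eventually_ge_at_top[of "1 :: nat"] by (rule eventually_mono) (rule v_le)
    show "(\<lambda>N. K / real N) \<longlonglongrightarrow> 0" by (rule lim_const_over_n)
  qed
qed

end
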